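(* Let $M=(M^{2n+s},f,\xi_i,\eta_i,g)$ be a trans-$S$-manifold with associated smooth functions $\alpha_i,\beta_i$ ($i=1,\dots,s$), and let $\gamma:I\to M$ be a Legendre Frenet curve of osculating order $r\ge 4$ with Frenet frame $\{T,E_2,\dots,E_r\}$ and curvatures $\kappa_1,\dots,\kappa_{r-1}$. Then $\gamma$ is $C$-proper in the tangent bundle, with non-zero function $\lambda$, if and only if there are smooth functions $w=w(t)$, $\varphi=\varphi(t)$ with $$\sum_{i=1}^s\xi_i=\sqrt{s}\,(\cos w\,E_2+\sin w\cos\varphi\,E_3+\sin w\sin\varphi\,E_4)$$ such that along $\gamma$ $$\kappa_1=\text{constant},$$ $$\sum_{i=1}^s\beta_i=-\sqrt{s}\,\kappa_1\cos w,$$ $$\lambda\sqrt{s}\cos w=\kappa_1(\kappa_1^2+\kappa_2^2),$$ $$\lambda\sqrt{s}\sin w\cos\varphi=-\kappa_1\kappa_2',$$ $$\lambda\sqrt{s}\sin w\sin\varphi=-\kappa_1\kappa_2\kappa_3,$$ $$\kappa_4=\frac{-\left(\sum_{i=1}^s\alpha_i\right)g(fT,E_5)}{\sqrt{s}\,\sin w\sin\varphi}.$$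
   Context: A framed metric $f$-manifold $(M^{2n+s},f,\xi_i,\eta_i,g)$ is a $(2n+s)$-dimensional Riemannian manifold $(M,g)$ with a $(1,1)$-tensor field $f$ of rank $2n$, vector fields $\xi_1,\dots,\xi_s$ and 1-forms $\eta_1,\dots,\eta_s$ such that $f^2=-I+\sum_i\eta_i\otimes\xi_i$, $\eta_i(\xi_j)=\delta_{ij}$, $f\xi_i=0$, $\eta_i\circ f=0$, $g(fX,fY)=g(X,Y)-\sum_i\eta_i(X)\eta_i(Y)$, and $\eta_i(X)=g(X,\xi_i)$. It is normal if $[f,f]+2\sum_i d\eta_i\otimes\xi_i=0$, where $[f,f]$ is the Nijenhuis tensor of $f$ and $2d\eta(X,Y)=X\eta(Y)-Y\eta(X)-\eta([X,Y])$. A trans-$S$-manifold is a normal framed metric $f$-manifold for which there are smooth functions $\alpha_i,\beta_i$ ($i=1,\dots,s$) with $$(\nabla_Xf)Y=\sum_{i=1}^s\Big[\alpha_i\{g(fX,fY)\xi_i+\eta_i(Y)f^2X\}+\beta_i\{g(fX,Y)\xi_i-\eta_i(Y)fX\}\Big]$$ for all vector fields $X,Y$, where $\nabla$ is the Levi-Civita connection of $g$. A Frenet curve of osculating order $r$ is a unit-speed curve $\gamma$ with orthonormal fields $E_1=T=\gamma',E_2,\dots,E_r$ along $\gamma$ and positive functions $\kappa_1,\dots,\kappa_{r-1}$ on $I$ with $\nabla_TE_1=\kappa_1E_2$, $\nabla_TE_j=-\kappa_{j-1}E_{j-1}+\kappa_jE_{j+1}$ ($2\le j\le r-1$), $\nabla_TE_r=-\kappa_{r-1}E_{r-1}$.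 Convention: when $r=4$, $\kappa_4=0$ and $E_5=0$. A curve is Legendre if $\eta_i(T)=0$ for all $i$. The mean curvature vector field is $H=\nabla_TT$, and the Laplacian along $\gamma$ is $\Delta H=-\nabla_T\nabla_TH$. $\gamma$ is $C$-proper in the tangent bundle (with function $\lambda$) if $\Delta H=\lambda\sum_{i=1}^s\xi_i$ along $\gamma$, where $\lambda$ is a non-zero (nowhere vanishing) differentiable real-valued function on $I$. Functions $\alpha_i,\beta_i$ in equations along $\gamma$ mean their restrictions to $\gamma$, and $'$ is the derivative in the arc-length parameter $t$. *)

theory Defs
  imports "HOL-Analysis.Analysis" "HOL-Library.Function_Algebras"
begin

(* Tangent vectors, vector fields and scalar functions are all functions, so the pointwise
   real vector space structure makes +, *\<^sub>R, sums and dim available for each of them. *)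

instantiation "fun" :: (type, real_vector) real_vector
begin

definition scaleR_fun :: "real \<Rightarrow> ('a \<Rightarrow> 'b) \<Rightarrow> 'a \<Rightarrow> 'b"
  where "scaleR_fun c f = (\<lambda>x. c *\<^sub>R f x)"

instance
  by standard (simp_all add: scaleR_fun_def fun_eq_iff scaleR_add_right scaleR_add_left)

end

section \<open>Smooth manifolds\<close>

(* Only meaningful for open S. *)

primrec Ck_on :: "nat \<Rightarrow> 'a::euclidean_space set \<Rightarrow> ('a \<Rightarrow> 'b::euclidean_space) \<Rightarrow> bool" where
  "Ck_on 0 S f \<longleftrightarrow> continuous_on S f"
| "Ck_on (Suc k) S f \<longleftrightarrow>
     f differentiable_on S \<and> (\<forall>v. Ck_on k S (\<lambda>x. frechet_derivative f (at x) v))"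

definition smooth_on :: "'a::euclidean_space set \<Rightarrow> ('a \<Rightarrow> 'b::euclidean_space) \<Rightarrow> bool"
  where "smooth_on S f \<longleftrightarrow> (\<forall>k. Ck_on k S f)"

type_synonym ('m, 'e) chart = "'m set \<times> ('m \<Rightarrow> 'e)"

definition chart :: "('m::topological_space, 'e::euclidean_space) chart \<Rightarrow> bool" where
  "chart c \<longleftrightarrow> (case c of (U, x) \<Rightarrow>
     open U \<and> open (x ` U) \<and> homeomorphism U (x ` U) x (inv_into U x))"

(* The atlas is not required to be maximal: everything below depends only on the smooth
   structure that it generates. *)

definition smooth_atlas ::
    "('m::{t2_space, second_countable_topology}, 'e::euclidean_space) chart set \<Rightarrow> bool" where
  "smooth_atlas A \<longleftrightarrow>
     (\<forall>c\<in>A. chart c) \<and> (\<Union>(U, x)\<in>A. U) = UNIV \<and>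
     (\<forall>(U, x)\<in>A. \<forall>(V, y)\<in>A. smooth_on (x ` (U \<inter> V)) (y \<circ> inv_into U x))"

definition smooth_fun ::
    "('m::topological_space, 'e::euclidean_space) chart set \<Rightarrow> ('m \<Rightarrow> real) \<Rightarrow> bool" where
  "smooth_fun A h \<longleftrightarrow> (\<forall>(U, x)\<in>A. smooth_on (x ` U) (h \<circ> inv_into U x))"

section \<open>Tangent vectors and tensor fields\<close>

(* Tangent vectors at p are the derivations at p of the algebra of smooth functions on M.  The
   value 0 on non-smooth functions makes equality of tangent vectors equality as derivations. *)

type_synonym 'm tvec = "('m \<Rightarrow> real) \<Rightarrow> real"
type_synonym 'm vfield = "'m \<Rightarrow> 'm tvec"

definition tangent_space ::
    "('m::topological_space, 'e::euclidean_space) chart set \<Rightarrow> 'm \<Rightarrow> 'm tvec set" where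
  "tangent_space A p = {v.
     (\<forall>h k. smooth_fun A h \<longrightarrow> smooth_fun A k \<longrightarrow>
        v (\<lambda>q. h q + k q) = v h + v k \<and>
        v (\<lambda>q. h q * k q) = h p * v k + k p * v h) \<and>
     (\<forall>c h. smooth_fun A h \<longrightarrow> v (\<lambda>q. c * h q) = c * v h) \<and>
     (\<forall>h. \<not> smooth_fun A h \<longrightarrow> v h = 0)}"

definition vector_field ::
    "('m::topological_space, 'e::euclidean_space) chart set \<Rightarrow> 'm vfield \<Rightarrow> bool" where
  "vector_field A X \<longleftrightarrow> (\<forall>p. X p \<in> tangent_space A p) \<and>
     (\<forall>h. smooth_fun A h \<longrightarrow> smooth_fun A (\<lambda>p. X p h))"

definition lie_bracket :: "'m vfield \<Rightarrow> 'm vfield \<Rightarrow> 'm vfield" where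
  "lie_bracket X Y = (\<lambda>p h. X p (\<lambda>q. Y q h) - Y p (\<lambda>q. X q h))"

definition linear_at ::
    "('m::topological_space, 'e::euclidean_space) chart set \<Rightarrow> 'm \<Rightarrow>
     ('m tvec \<Rightarrow> 'b::real_vector) \<Rightarrow> bool" where
  "linear_at A p L \<longleftrightarrow>
     (\<forall>u\<in>tangent_space A p. \<forall>v\<in>tangent_space A p. L (u + v) = L u + L v) \<and>
     (\<forall>c. \<forall>u\<in>tangent_space A p. L (c *\<^sub>R u) = c *\<^sub>R L u)"

definition one_form ::
    "('m::topological_space, 'e::euclidean_space) chart set \<Rightarrow> ('m \<Rightarrow> 'm tvec \<Rightarrow> real) \<Rightarrow> bool" where
  "one_form A \<omega> \<longleftrightarrow> (\<forall>p. linear_at A p (\<omega> p)) \<and>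
     (\<forall>X. vector_field A X \<longrightarrow> smooth_fun A (\<lambda>p. \<omega> p (X p)))"

definition tensor_11 ::
    "('m::topological_space, 'e::euclidean_space) chart set \<Rightarrow> ('m \<Rightarrow> 'm tvec \<Rightarrow> 'm tvec) \<Rightarrow> bool"
  where
  "tensor_11 A f \<longleftrightarrow>
     (\<forall>p. linear_at A p (f p) \<and> f p ` tangent_space A p \<subseteq> tangent_space A p) \<and>
     (\<forall>X. vector_field A X \<longrightarrow> vector_field A (\<lambda>p. f p (X p)))"

definition riemannian_metric ::
    "('m::topological_space, 'e::euclidean_space) chart set \<Rightarrow>
     ('m \<Rightarrow> 'm tvec \<Rightarrow> 'm tvec \<Rightarrow> real) \<Rightarrow> bool" where
  "riemannian_metric A g \<longleftrightarrow>
     (\<forall>p. \<forall>u\<in>tangent_space A p.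
        linear_at A p (g p u) \<and>
        (\<forall>v\<in>tangent_space A p. g p u v = g p v u) \<and>
        (u \<noteq> 0 \<longrightarrow> g p u u > 0)) \<and>
     (\<forall>X Y. vector_field A X \<longrightarrow> vector_field A Y \<longrightarrow> smooth_fun A (\<lambda>p. g p (X p) (Y p)))"

section \<open>The Levi-Civita connection\<close>

definition affine_connection ::
    "('m::topological_space, 'e::euclidean_space) chart set \<Rightarrow>
     ('m vfield \<Rightarrow> 'm vfield \<Rightarrow> 'm vfield) \<Rightarrow> bool" where
  "affine_connection A nabla \<longleftrightarrow>
     (\<forall>X Y. vector_field A X \<longrightarrow> vector_field A Y \<longrightarrow> vector_field A (nabla X Y)) \<and>
     (\<forall>X X' Y. vector_field A X \<longrightarrow> vector_field A X' \<longrightarrow> vector_field A Y \<longrightarrow>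
        nabla (X + X') Y = nabla X Y + nabla X' Y) \<and>
     (\<forall>h X Y. smooth_fun A h \<longrightarrow> vector_field A X \<longrightarrow> vector_field A Y \<longrightarrow>
        nabla (\<lambda>p. h p *\<^sub>R X p) Y = (\<lambda>p. h p *\<^sub>R nabla X Y p)) \<and>
     (\<forall>X Y Y'. vector_field A X \<longrightarrow> vector_field A Y \<longrightarrow> vector_field A Y' \<longrightarrow>
        nabla X (Y + Y') = nabla X Y + nabla X Y') \<and>
     (\<forall>h X Y. smooth_fun A h \<longrightarrow> vector_field A X \<longrightarrow> vector_field A Y \<longrightarrow>
        nabla X (\<lambda>p. h p *\<^sub>R Y p) = (\<lambda>p. X p h *\<^sub>R Y p + h p *\<^sub>R nabla X Y p))"

definition levi_civita ::
    "('m::topological_space, 'e::euclidean_space) chart set \<Rightarrow>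
     ('m \<Rightarrow> 'm tvec \<Rightarrow> 'm tvec \<Rightarrow> real) \<Rightarrow> ('m vfield \<Rightarrow> 'm vfield \<Rightarrow> 'm vfield) \<Rightarrow> bool" where
  "levi_civita A g nabla \<longleftrightarrow> affine_connection A nabla \<and>
     (\<forall>X Y. vector_field A X \<longrightarrow> vector_field A Y \<longrightarrow>
        nabla X Y - nabla Y X = lie_bracket X Y) \<and>
     (\<forall>X Y Z p. vector_field A X \<longrightarrow> vector_field A Y \<longrightarrow> vector_field A Z \<longrightarrow>
        X p (\<lambda>q. g q (Y q) (Z q)) = g p (nabla X Y p) (Z p) + g p (Y p) (nabla X Z p))"

section \<open>Trans-S-manifolds\<close>

definition framed_metric_f_manifold ::
    "('m::{t2_space, second_countable_topology}, 'e::euclidean_space) chart set \<Rightarrow> nat \<Rightarrow> nat \<Rightarrow>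
     ('m \<Rightarrow> 'm tvec \<Rightarrow> 'm tvec) \<Rightarrow> (nat \<Rightarrow> 'm vfield) \<Rightarrow> (nat \<Rightarrow> 'm \<Rightarrow> 'm tvec \<Rightarrow> real) \<Rightarrow>
     ('m \<Rightarrow> 'm tvec \<Rightarrow> 'm tvec \<Rightarrow> real) \<Rightarrow> bool" where
  "framed_metric_f_manifold A n s f \<xi> \<eta> g \<longleftrightarrow>
     smooth_atlas A \<and> DIM('e) = 2 * n + s \<and> 1 \<le> s \<and>
     riemannian_metric A g \<and> tensor_11 A f \<and>
     (\<forall>i\<in>{1..s}. vector_field A (\<xi> i) \<and> one_form A (\<eta> i)) \<and>
     (\<forall>p. dim (f p ` tangent_space A p) = 2 * n) \<and>
     (\<forall>p. \<forall>u\<in>tangent_space A p. f p (f p u) = - u + (\<Sum>i=1..s. \<eta> i p u *\<^sub>R \<xi> i p)) \<and>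
     (\<forall>p. \<forall>i\<in>{1..s}. \<forall>j\<in>{1..s}. \<eta> i p (\<xi> j p) = (if i = j then 1 else 0)) \<and>
     (\<forall>p. \<forall>i\<in>{1..s}. f p (\<xi> i p) = 0) \<and>
     (\<forall>p. \<forall>i\<in>{1..s}. \<forall>u\<in>tangent_space A p. \<eta> i p (f p u) = 0) \<and>
     (\<forall>p. \<forall>u\<in>tangent_space A p. \<forall>v\<in>tangent_space A p.
        g p (f p u) (f p v) = g p u v - (\<Sum>i=1..s. \<eta> i p u * \<eta> i p v)) \<and>
     (\<forall>p. \<forall>i\<in>{1..s}. \<forall>u\<in>tangent_space A p. \<eta> i p u = g p u (\<xi> i p))"

(* The convention for d\<omega> with the factor 1/2. *)

definition ext_deriv ::
    "('m \<Rightarrow> 'm tvec \<Rightarrow> real) \<Rightarrow> 'm vfield \<Rightarrow> 'm vfield \<Rightarrow> 'm \<Rightarrow> real" where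
  "ext_deriv \<omega> X Y p =
     (X p (\<lambda>q. \<omega> q (Y q)) - Y p (\<lambda>q. \<omega> q (X q)) - \<omega> p (lie_bracket X Y p)) / 2"

definition nijenhuis ::
    "('m \<Rightarrow> 'm tvec \<Rightarrow> 'm tvec) \<Rightarrow> 'm vfield \<Rightarrow> 'm vfield \<Rightarrow> 'm vfield" where
  "nijenhuis f X Y p =
     f p (f p (lie_bracket X Y p)) + lie_bracket (\<lambda>q. f q (X q)) (\<lambda>q. f q (Y q)) p
     - f p (lie_bracket (\<lambda>q. f q (X q)) Y p) - f p (lie_bracket X (\<lambda>q. f q (Y q)) p)"

definition normal_framed ::
    "('m::topological_space, 'e::euclidean_space) chart set \<Rightarrow> nat \<Rightarrow>
     ('m \<Rightarrow> 'm tvec \<Rightarrow> 'm tvec) \<Rightarrow> (nat \<Rightarrow> 'm vfield) \<Rightarrow> (nat \<Rightarrow> 'm \<Rightarrow> 'm tvec \<Rightarrow> real) \<Rightarrow> bool" where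
  "normal_framed A s f \<xi> \<eta> \<longleftrightarrow>
     (\<forall>X Y p. vector_field A X \<longrightarrow> vector_field A Y \<longrightarrow>
        nijenhuis f X Y p + 2 *\<^sub>R (\<Sum>i=1..s. ext_deriv (\<eta> i) X Y p *\<^sub>R \<xi> i p) = 0)"

definition cov_deriv_tensor ::
    "('m vfield \<Rightarrow> 'm vfield \<Rightarrow> 'm vfield) \<Rightarrow> ('m \<Rightarrow> 'm tvec \<Rightarrow> 'm tvec) \<Rightarrow>
     'm vfield \<Rightarrow> 'm vfield \<Rightarrow> 'm vfield" where
  "cov_deriv_tensor nabla f X Y p = nabla X (\<lambda>q. f q (Y q)) p - f p (nabla X Y p)"

definition trans_S_manifold ::
    "('m::{t2_space, second_countable_topology}, 'e::euclidean_space) chart set \<Rightarrow> nat \<Rightarrow> nat \<Rightarrow>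
     ('m \<Rightarrow> 'm tvec \<Rightarrow> 'm tvec) \<Rightarrow> (nat \<Rightarrow> 'm vfield) \<Rightarrow> (nat \<Rightarrow> 'm \<Rightarrow> 'm tvec \<Rightarrow> real) \<Rightarrow>
     ('m \<Rightarrow> 'm tvec \<Rightarrow> 'm tvec \<Rightarrow> real) \<Rightarrow> ('m vfield \<Rightarrow> 'm vfield \<Rightarrow> 'm vfield) \<Rightarrow>
     (nat \<Rightarrow> 'm \<Rightarrow> real) \<Rightarrow> (nat \<Rightarrow> 'm \<Rightarrow> real) \<Rightarrow> bool" where
  "trans_S_manifold A n s f \<xi> \<eta> g nabla \<alpha> \<beta> \<longleftrightarrow>
     framed_metric_f_manifold A n s f \<xi> \<eta> g \<and> normal_framed A s f \<xi> \<eta> \<and>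
     levi_civita A g nabla \<and>
     (\<forall>i\<in>{1..s}. smooth_fun A (\<alpha> i) \<and> smooth_fun A (\<beta> i)) \<and>
     (\<forall>X Y p. vector_field A X \<longrightarrow> vector_field A Y \<longrightarrow>
        cov_deriv_tensor nabla f X Y p =
          (\<Sum>i=1..s.
             \<alpha> i p *\<^sub>R (g p (f p (X p)) (f p (Y p)) *\<^sub>R \<xi> i p + \<eta> i p (Y p) *\<^sub>R f p (f p (X p))) +
             \<beta> i p *\<^sub>R (g p (f p (X p)) (Y p) *\<^sub>R \<xi> i p - \<eta> i p (Y p) *\<^sub>R f p (X p))))"

section \<open>Curves\<close>

definition smooth_curve ::
    "('m::topological_space, 'e::euclidean_space) chart set \<Rightarrow> real set \<Rightarrow> (real \<Rightarrow> 'm) \<Rightarrow> bool" where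
  "smooth_curve A I \<gamma> \<longleftrightarrow> continuous_on I \<gamma> \<and>
     (\<forall>(U, x)\<in>A. smooth_on {t\<in>I. \<gamma> t \<in> U} (x \<circ> \<gamma>))"

definition velocity ::
    "('m::topological_space, 'e::euclidean_space) chart set \<Rightarrow> (real \<Rightarrow> 'm) \<Rightarrow> real \<Rightarrow> 'm tvec" where
  "velocity A \<gamma> t = (\<lambda>h. if smooth_fun A h then deriv (\<lambda>\<tau>. h (\<gamma> \<tau>)) t else 0)"

definition field_along ::
    "('m::topological_space, 'e::euclidean_space) chart set \<Rightarrow> real set \<Rightarrow> (real \<Rightarrow> 'm) \<Rightarrow>
     (real \<Rightarrow> 'm tvec) \<Rightarrow> bool" where
  "field_along A I \<gamma> V \<longleftrightarrow> (\<forall>t\<in>I. V t \<in> tangent_space A (\<gamma> t)) \<and>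
     (\<forall>h. smooth_fun A h \<longrightarrow> smooth_on I (\<lambda>t. V t h))"

(* The covariant derivative D along \<gamma> : I \<rightarrow> M (that is, \<nabla>\<^sub>T with T = \<gamma>') induced by nabla, given by
   the properties which determine it uniquely on smooth fields along \<gamma>.  In the last one
   nabla X Y (\<gamma> t) is \<nabla>\<^sub>v Y for the vector v = \<gamma>'(t), as a connection depends only on the value of X
   at the point.  Fields along \<gamma> are represented by functions on all of \<real>, hence the requirement
   that D ignores the values outside I. *)

definition cov_deriv_along ::
    "('m::topological_space, 'e::euclidean_space) chart set \<Rightarrow>
     ('m vfield \<Rightarrow> 'm vfield \<Rightarrow> 'm vfield) \<Rightarrow> real set \<Rightarrow> (real \<Rightarrow> 'm) \<Rightarrow>
     ((real \<Rightarrow> 'm tvec) \<Rightarrow> real \<Rightarrow> 'm tvec) \<Rightarrow> bool" where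
  "cov_deriv_along A nabla I \<gamma> D \<longleftrightarrow>
     (\<forall>V. field_along A I \<gamma> V \<longrightarrow> field_along A I \<gamma> (D V)) \<and>
     (\<forall>V W. field_along A I \<gamma> V \<longrightarrow> field_along A I \<gamma> W \<longrightarrow>
        (\<forall>t\<in>I. V t = W t) \<longrightarrow> (\<forall>t\<in>I. D V t = D W t)) \<and>
     (\<forall>V W. field_along A I \<gamma> V \<longrightarrow> field_along A I \<gamma> W \<longrightarrow>
        (\<forall>t\<in>I. D (V + W) t = D V t + D W t)) \<and>
     (\<forall>u V. smooth_on I u \<longrightarrow> field_along A I \<gamma> V \<longrightarrow>
        (\<forall>t\<in>I. D (\<lambda>\<tau>. u \<tau> *\<^sub>R V \<tau>) t = deriv u t *\<^sub>R V t + u t *\<^sub>R D V t)) \<and>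
     (\<forall>X Y. vector_field A X \<longrightarrow> vector_field A Y \<longrightarrow>
        (\<forall>t\<in>I. X (\<gamma> t) = velocity A \<gamma> t \<longrightarrow> D (\<lambda>\<tau>. Y (\<gamma> \<tau>)) t = nabla X Y (\<gamma> t)))"

(* The Frenet equations, with the terms containing \<kappa> 0 and \<kappa> r absent. *)

definition frenet_curve ::
    "('m::topological_space, 'e::euclidean_space) chart set \<Rightarrow>
     ('m \<Rightarrow> 'm tvec \<Rightarrow> 'm tvec \<Rightarrow> real) \<Rightarrow> real set \<Rightarrow> (real \<Rightarrow> 'm) \<Rightarrow>
     ((real \<Rightarrow> 'm tvec) \<Rightarrow> real \<Rightarrow> 'm tvec) \<Rightarrow> nat \<Rightarrow>
     (nat \<Rightarrow> real \<Rightarrow> 'm tvec) \<Rightarrow> (nat \<Rightarrow> real \<Rightarrow> real) \<Rightarrow> bool" where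
  "frenet_curve A g I \<gamma> D r E \<kappa> \<longleftrightarrow>
     smooth_curve A I \<gamma> \<and>
     (\<forall>t\<in>I. g (\<gamma> t) (velocity A \<gamma> t) (velocity A \<gamma> t) = 1) \<and>
     1 \<le> r \<and>
     (\<forall>j\<in>{1..r}. field_along A I \<gamma> (E j)) \<and>
     (\<forall>t\<in>I. E 1 t = velocity A \<gamma> t) \<and>
     (\<forall>i\<in>{1..r}. \<forall>j\<in>{1..r}. \<forall>t\<in>I. g (\<gamma> t) (E i t) (E j t) = (if i = j then 1 else 0)) \<and>
     (\<forall>j\<in>{1..<r}. smooth_on I (\<kappa> j) \<and> (\<forall>t\<in>I. \<kappa> j t > 0)) \<and>
     (\<forall>j\<in>{1..r}. \<forall>t\<in>I. D (E j) t =
        (if j = 1 then 0 else - (\<kappa> (j - 1) t *\<^sub>R E (j - 1) t)) +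
        (if j = r then 0 else \<kappa> j t *\<^sub>R E (j + 1) t))"

definition legendre_curve ::
    "('m::topological_space, 'e::euclidean_space) chart set \<Rightarrow> nat \<Rightarrow>
     (nat \<Rightarrow> 'm \<Rightarrow> 'm tvec \<Rightarrow> real) \<Rightarrow> real set \<Rightarrow> (real \<Rightarrow> 'm) \<Rightarrow> bool" where
  "legendre_curve A s \<eta> I \<gamma> \<longleftrightarrow> (\<forall>i\<in>{1..s}. \<forall>t\<in>I. \<eta> i (\<gamma> t) (velocity A \<gamma> t) = 0)"

definition mean_curvature ::
    "('m::topological_space, 'e::euclidean_space) chart set \<Rightarrow> (real \<Rightarrow> 'm) \<Rightarrow>
     ((real \<Rightarrow> 'm tvec) \<Rightarrow> real \<Rightarrow> 'm tvec) \<Rightarrow> real \<Rightarrow> 'm tvec" where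
  "mean_curvature A \<gamma> D = D (velocity A \<gamma>)"

definition laplacian_along ::
    "((real \<Rightarrow> 'm tvec) \<Rightarrow> real \<Rightarrow> 'm tvec) \<Rightarrow> (real \<Rightarrow> 'm tvec) \<Rightarrow> real \<Rightarrow> 'm tvec" where
  "laplacian_along D V = (\<lambda>t. - D (D V) t)"

definition C_proper_tangent ::
    "('m::topological_space, 'e::euclidean_space) chart set \<Rightarrow> nat \<Rightarrow> (nat \<Rightarrow> 'm vfield) \<Rightarrow>
     real set \<Rightarrow> (real \<Rightarrow> 'm) \<Rightarrow> ((real \<Rightarrow> 'm tvec) \<Rightarrow> real \<Rightarrow> 'm tvec) \<Rightarrow>
     (real \<Rightarrow> real) \<Rightarrow> bool" where
  "C_proper_tangent A s \<xi> I \<gamma> D lam \<longleftrightarrow>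
     lam differentiable_on I \<and> (\<forall>t\<in>I. lam t \<noteq> 0) \<and>
     (\<forall>t\<in>I. laplacian_along D (mean_curvature A \<gamma> D) t = lam t *\<^sub>R (\<Sum>i=1..s. \<xi> i (\<gamma> t)))"

end

theory Submission
  imports Defs
begin

text \<open>For a Legendre curve the field \<open>\<Xi> = \<Sum>\<^sub>i \<xi>\<^sub>i\<close> is orthogonal to \<open>T\<close> and has length \<open>\<surd>s\<close>.  The
  Frenet equations express \<open>\<Delta>H\<close> in \<open>T, E\<^sub>2, E\<^sub>3, E\<^sub>4\<close>; if \<open>\<Delta>H = \<lambda>\<Xi>\<close>, the \<open>T\<close>-component gives
  \<open>\<kappa>\<^sub>1' = 0\<close>, so \<open>\<Xi>/\<surd>s\<close> is a unit field in the span of \<open>E\<^sub>2, E\<^sub>3, E\<^sub>4\<close> whose \<open>E\<^sub>4\<close>-component has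
  constant sign, and \<open>w, \<phi>\<close> are its spherical coordinates.  Their smoothness rests on that of \<open>\<lambda>\<close>,
  which equals the square root of a positive smooth function up to a constant sign.

  The conditions on \<open>\<alpha>\<^sub>i, \<beta>\<^sub>i\<close> come from differentiating \<open>\<Xi>\<close> once.  The structure equation gives
  \<open>\<nabla>\<^sub>T\<xi>\<^sub>j = -\<alpha>\<^sub>j fT + \<beta>\<^sub>j T\<close> up to a combination of the \<open>\<xi>\<^sub>i\<close>, which vanishes by normality since \<open>T\<close>
  is Legendre.  Compare the \<open>T\<close>- and \<open>E\<^sub>5\<close>-components with those obtained from the Frenet equations.\<close>

section \<open>Smooth functions on open sets\<close>

text \<open>Openness of \<open>S\<close> matters here: \<open>frechet_derivative f (at x)\<close>
  sees a full neighbourhood of \<open>x\<close>, and only for open \<open>S\<close> is that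
  neighbourhood covered by the agreement on \<open>S\<close>.\<close>

lemma Ck_on_cong:
  assumes "open S" "\<And>x. x \<in> S \<Longrightarrow> f x = h x" "Ck_on k S f"
  shows "Ck_on k S h"
  using assms(2,3)
proof (induction k arbitrary: f h)
  case 0
  then show ?case using continuous_on_cong by (metis Ck_on.simps(1))
next
  case (Suc k)
  have fr: "frechet_derivative f (at x) v = frechet_derivative h (at x) v" if "x \<in> S" for x v
  proof -
    have "f differentiable (at x)"
      using Suc.prems(2) that assms(1) by (simp add: differentiable_on_eq_differentiable_at)
    then have "(f has_derivative frechet_derivative f (at x)) (at x)"
      using frechet_derivative_works by blast
    then have "(h has_derivative frechet_derivative f (at x)) (at x)"
      by (rule has_derivative_transform_within_open[OF _ assms(1) that]) (use Suc.prems(1) in auto)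
    then show ?thesis using frechet_derivative_at by metis
  qed
  have "h differentiable_on S"
    using Suc.prems differentiable_transform_within[of f _ S 1 h]
    by (auto simp: differentiable_on_def)
  moreover have "Ck_on k S (\<lambda>x. frechet_derivative h (at x) v)" for v
    by (rule Suc.IH[of "\<lambda>x. frechet_derivative f (at x) v"]) (use fr Suc.prems(2) in simp_all)
  ultimately show ?case by simp
qed

lemma Ck_on_subset: "Ck_on k S f \<Longrightarrow> T \<subseteq> S \<Longrightarrow> Ck_on k T f"
proof (induction k arbitrary: f)
  case 0
  then show ?case using continuous_on_subset by auto
next
  case (Suc k)
  then show ?case using differentiable_on_subset by (simp, blast)
qed

text \<open>Continuity and differentiability are pointwise conditions, and the derivatives
  \<open>frechet_derivative f (at x) v\<close> are formed independently of the set, so the same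
  local statement passes to them. This is how smoothness is glued from charts.\<close>

lemma Ck_on_local:
  assumes "\<And>x. x \<in> S \<Longrightarrow> \<exists>U. open U \<and> x \<in> U \<and> U \<subseteq> S \<and> Ck_on k U f"
  shows "Ck_on k S f"
  using assms
proof (induction k arbitrary: f)
  case 0
  have "continuous (at x within S) f" if x: "x \<in> S" for x
  proof -
    obtain U where "open U" "x \<in> U" "continuous_on U f" using 0[OF x] unfolding Ck_on.simps by blast
    then have "continuous (at x) f" by (simp add: continuous_on_eq_continuous_at)
    then show ?thesis using continuous_at_imp_continuous_at_within by blast
  qed
  then show ?case by (simp add: continuous_on_eq_continuous_within)
next
  case (Suc k)
  have "f differentiable (at x within S)" if x: "x \<in> S" for x
  proof -
    obtain U where "open U" "x \<in> U" "f differentiable_on U"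
      using Suc.prems[OF x] unfolding Ck_on.simps by blast
    then have "f differentiable (at x)" by (simp add: differentiable_on_eq_differentiable_at)
    then show ?thesis using differentiable_at_withinI by blast
  qed
  then have "f differentiable_on S" by (simp add: differentiable_on_def)
  moreover have "Ck_on k S (\<lambda>x. frechet_derivative f (at x) v)" for v
  proof (rule Suc.IH)
    fix x assume "x \<in> S"
    from Suc.prems[OF this] obtain U where "open U \<and> x \<in> U \<and> U \<subseteq> S" "Ck_on (Suc k) U f" by blast
    then show "\<exists>U. open U \<and> x \<in> U \<and> U \<subseteq> S \<and> Ck_on k U (\<lambda>x. frechet_derivative f (at x) v)"
      by (intro exI[of _ U]) simp
  qed
  ultimately show ?case by simp
qed

lemma Ck_on_SucD: "Ck_on (Suc k) S f \<Longrightarrow> Ck_on k S f"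
proof (induction k arbitrary: f)
  case 0
  then show ?case using differentiable_imp_continuous_on by auto
next
  case (Suc k)
  from Suc.prems show ?case by (simp add: Suc.IH)
qed

text \<open>By uniqueness of derivatives on an open set, any explicitly known derivative may stand
  in for \<open>frechet_derivative\<close>; the inductions below rest on this form.\<close>

lemma Ck_on_SucI:
  assumes "open S" "\<And>x. x \<in> S \<Longrightarrow> (f has_derivative f' x) (at x)"
    and "\<And>v. Ck_on k S (\<lambda>x. f' x v)"
  shows "Ck_on (Suc k) S f"
proof -
  have "f differentiable_on S"
    using assms(1,2) by (auto simp: differentiable_on_eq_differentiable_at differentiable_def)
  moreover have "Ck_on k S (\<lambda>x. frechet_derivative f (at x) v)" for v
    by (rule Ck_on_cong[OF assms(1) _ assms(3)[of v]])
       (simp add: frechet_derivative_at[OF assms(2), symmetric])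
  ultimately show ?thesis by simp
qed

lemma Ck_on_has_derivative:
  assumes "Ck_on (Suc k) S f" "open S" "x \<in> S"
  shows "(f has_derivative frechet_derivative f (at x)) (at x)"
  using assms frechet_derivative_works by (auto simp: differentiable_on_eq_differentiable_at)

lemma Ck_on_const: "open S \<Longrightarrow> Ck_on k S (\<lambda>x. c)"
  by (induction k arbitrary: c) (simp_all add: frechet_derivative_const)

lemma Ck_on_add:
  assumes "open S" "Ck_on k S f" "Ck_on k S h"
  shows "Ck_on k S (\<lambda>x. f x + h x)"
  using assms(2,3)
proof (induction k arbitrary: f h)
  case (Suc k)
  show ?case
    by (rule Ck_on_SucI[OF assms(1) has_derivative_add[OF Suc.prems(1)[THEN Ck_on_has_derivative, OF assms(1)]
        Suc.prems(2)[THEN Ck_on_has_derivative, OF assms(1)]]]) (use Suc.IH Suc.prems in simp_all)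
qed (auto intro: continuous_on_add)

lemma Ck_on_linear:
  assumes "bounded_linear L" "open S" "Ck_on k S f"
  shows "Ck_on k S (\<lambda>x. L (f x))"
  using assms(3)
proof (induction k arbitrary: f)
  case 0
  then show ?case using assms bounded_linear.continuous_on by auto
next
  case (Suc k)
  show ?case
    by (rule Ck_on_SucI[OF assms(2) bounded_linear.has_derivative[OF assms(1) Suc.prems[THEN Ck_on_has_derivative, OF assms(2)]]])
       (use Suc.IH Suc.prems in simp_all)
qed

lemma Ck_on_bilinear:
  assumes "bounded_bilinear B" "open S" "Ck_on k S f" "Ck_on k S h"
  shows "Ck_on k S (\<lambda>x. B (f x) (h x))"
  using assms(3,4)
proof (induction k arbitrary: f h)
  case 0
  then show ?case using assms bounded_bilinear.continuous_on by auto
next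
  case (Suc k)
  show ?case
  proof (rule Ck_on_SucI[OF assms(2) bounded_bilinear.FDERIV[OF assms(1) Suc.prems(1)[THEN Ck_on_has_derivative, OF assms(2)]
        Suc.prems(2)[THEN Ck_on_has_derivative, OF assms(2)]]])
    show "Ck_on k S (\<lambda>x. B (f x) (frechet_derivative h (at x) v) + B (frechet_derivative f (at x) v) (h x))" for v
      by (intro Ck_on_add assms(2) Suc.IH Suc.prems[THEN Ck_on_SucD])
         (use Suc.prems in simp_all)
  qed
qed

lemma Ck_on_sum:
  assumes "open S" "\<And>i. i \<in> J \<Longrightarrow> Ck_on k S (f i)"
  shows "Ck_on k S (\<lambda>x. \<Sum>i\<in>J. f i x)"
  using assms(2)
  by (induction J rule: infinite_finite_induct) (auto intro: Ck_on_add Ck_on_const assms(1))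

lemma Ck_on_compose:
  assumes "open S" "open T" "h ` S \<subseteq> T" "Ck_on k T f" "Ck_on k S h"
  shows "Ck_on k S (\<lambda>x. f (h x))"
  using assms(3-5)
proof (induction k arbitrary: f h)
  case 0
  then show ?case by (auto intro: continuous_on_compose2)
next
  case (Suc k)
  \<comment> \<open>The chain rule differentiates \<open>f\<close> in the direction
    \<open>frechet_derivative h (at x) v\<close>, which moves with \<open>x\<close>, whereas the
    induction hypothesis speaks of fixed directions. Expanding in the basis separates the moving
    coefficients from derivatives in fixed directions.\<close>
  have eq: "frechet_derivative f (at y) u = (\<Sum>b\<in>Basis. (u \<bullet> b) *\<^sub>R frechet_derivative f (at y) b)"
    if "y \<in> T" for y u
  proof -
    have lin: "linear (frechet_derivative f (at y))"
      using Ck_on_has_derivative[OF Suc.prems(2) assms(2) that] by (rule has_derivative_linear)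
    have "frechet_derivative f (at y) u = frechet_derivative f (at y) (\<Sum>b\<in>Basis. (u \<bullet> b) *\<^sub>R b)"
      by (simp only: euclidean_representation)
    also have "\<dots> = (\<Sum>b\<in>Basis. (u \<bullet> b) *\<^sub>R frechet_derivative f (at y) b)"
      by (simp only: linear_sum[OF lin] linear_scale[OF lin])
    finally show ?thesis .
  qed
  show ?case
  proof (rule Ck_on_SucI[OF assms(1)])
    fix x assume x: "x \<in> S"
    then have "h x \<in> T" using Suc.prems(1) by blast
    then show "((\<lambda>x. f (h x)) has_derivative
        (\<lambda>v. frechet_derivative f (at (h x)) (frechet_derivative h (at x) v))) (at x)"
      by (rule has_derivative_compose[OF Ck_on_has_derivative[OF Suc.prems(3) assms(1) x]
          Ck_on_has_derivative[OF Suc.prems(2) assms(2)]])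
  next
    fix v
    have "Ck_on k S (\<lambda>x. \<Sum>b\<in>Basis. (frechet_derivative h (at x) v \<bullet> b) *\<^sub>R
        frechet_derivative f (at (h x)) b)"
    proof (intro Ck_on_sum[OF assms(1)] Ck_on_bilinear[OF bounded_bilinear_scaleR assms(1)]
        Ck_on_linear[OF bounded_linear_inner_left assms(1)])
      show "Ck_on k S (\<lambda>x. frechet_derivative h (at x) v)" using Suc.prems(3) by simp
      show "Ck_on k S (\<lambda>x. frechet_derivative f (at (h x)) b)" for b
        by (rule Suc.IH[of h "\<lambda>y. frechet_derivative f (at y) b", OF Suc.prems(1) _ Ck_on_SucD[OF Suc.prems(3)]])
           (use Suc.prems(2) in simp)
    qed
    then show "Ck_on k S (\<lambda>x. frechet_derivative f (at (h x)) (frechet_derivative h (at x) v))"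
      by (rule Ck_on_cong[OF assms(1), rotated]) (subst eq, use Suc.prems(1) in auto)
  qed
qed

lemma Ck_on_SucI_real:
  fixes f :: "real \<Rightarrow> real"
  assumes "open S" "\<And>x. x \<in> S \<Longrightarrow> (f has_real_derivative f' x) (at x)" "Ck_on k S f'"
  shows "Ck_on (Suc k) S f"
proof (rule Ck_on_SucI[OF assms(1)])
  show "x \<in> S \<Longrightarrow> (f has_derivative (\<lambda>v. f' x * v)) (at x)" for x
    using assms(2) has_field_derivative_def by blast
  show "Ck_on k S (\<lambda>x. f' x * v)" for v
    using assms(1,3) by (intro Ck_on_bilinear[OF bounded_bilinear_mult] Ck_on_const)
qed

lemmas Ck_on_mult = Ck_on_bilinear[OF bounded_bilinear_mult]

lemma smooth_on_cong: "open S \<Longrightarrow> smooth_on S f \<Longrightarrow> (\<And>x. x \<in> S \<Longrightarrow> f x = h x) \<Longrightarrow> smooth_on S h"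
  unfolding smooth_on_def using Ck_on_cong by blast

lemma smooth_on_subset: "smooth_on S f \<Longrightarrow> T \<subseteq> S \<Longrightarrow> smooth_on T f"
  unfolding smooth_on_def using Ck_on_subset by blast

lemma smooth_on_local:
  assumes "\<And>x. x \<in> S \<Longrightarrow> \<exists>U. open U \<and> x \<in> U \<and> U \<subseteq> S \<and> smooth_on U f"
  shows "smooth_on S f"
  unfolding smooth_on_def using Ck_on_local assms unfolding smooth_on_def by metis

lemma smooth_on_const: "open S \<Longrightarrow> smooth_on S (\<lambda>x. c)"
  by (simp add: smooth_on_def Ck_on_const)

lemma smooth_on_add: "open S \<Longrightarrow> smooth_on S f \<Longrightarrow> smooth_on S h \<Longrightarrow> smooth_on S (\<lambda>x. f x + h x)"
  by (simp add: smooth_on_def Ck_on_add)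

lemma smooth_on_mult:
  fixes f h :: "'a::euclidean_space \<Rightarrow> real"
  shows "open S \<Longrightarrow> smooth_on S f \<Longrightarrow> smooth_on S h \<Longrightarrow> smooth_on S (\<lambda>x. f x * h x)"
  by (simp add: smooth_on_def Ck_on_mult)

lemma smooth_on_uminus:
  fixes f :: "'a::euclidean_space \<Rightarrow> real"
  shows "open S \<Longrightarrow> smooth_on S f \<Longrightarrow> smooth_on S (\<lambda>x. - f x)"
  using smooth_on_mult[OF _ smooth_on_const[of S "-1"], of f] by simp

lemma smooth_on_compose:
  "open S \<Longrightarrow> open T \<Longrightarrow> h ` S \<subseteq> T \<Longrightarrow> smooth_on T f \<Longrightarrow> smooth_on S h \<Longrightarrow> smooth_on S (\<lambda>x. f (h x))"
  unfolding smooth_on_def using Ck_on_compose by blast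

lemma smooth_on_has_derivative:
  "smooth_on S f \<Longrightarrow> open S \<Longrightarrow> x \<in> S \<Longrightarrow> (f has_derivative frechet_derivative f (at x)) (at x)"
  unfolding smooth_on_def using Ck_on_has_derivative by blast

lemma smooth_on_frechet_derivative:
  "smooth_on S f \<Longrightarrow> smooth_on S (\<lambda>x. frechet_derivative f (at x) v)"
  unfolding smooth_on_def by (metis Ck_on.simps(2))

lemma smooth_on_has_real_derivative:
  fixes f :: "real \<Rightarrow> real"
  assumes "smooth_on S f" "open S" "x \<in> S"
  shows "(f has_real_derivative deriv f x) (at x)"
  using smooth_on_has_derivative[OF assms] differentiableI
  by (metis DERIV_deriv_iff_real_differentiable)

lemma smooth_on_imp_differentiable_on: "smooth_on S f \<Longrightarrow> f differentiable_on S"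
  unfolding smooth_on_def by (metis Ck_on.simps(2))

lemma smooth_on_deriv:
  fixes f :: "real \<Rightarrow> real"
  assumes "smooth_on S f" "open S"
  shows "smooth_on S (deriv f)"
proof (rule smooth_on_cong[OF assms(2) smooth_on_frechet_derivative[OF assms(1), of 1]])
  fix x assume "x \<in> S"
  from smooth_on_has_real_derivative[OF assms this]
  have "(f has_derivative (\<lambda>v. deriv f x * v)) (at x)" using has_field_derivative_def by blast
  from frechet_derivative_at[OF this] show "frechet_derivative f (at x) 1 = deriv f x"
    by (metis mult.right_neutral)
qed

section \<open>Smoothness of elementary functions\<close>

lemma smooth_on_ident: "open S \<Longrightarrow> smooth_on S (\<lambda>x. x)"
  unfolding smooth_on_def
proof
  assume S: "open S"
  show "Ck_on k S (\<lambda>x. x)" for k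
  proof (cases k)
    case (Suc l)
    show ?thesis unfolding Suc by (rule Ck_on_SucI[OF S has_derivative_ident]) (rule Ck_on_const[OF S])
  qed auto
qed

text \<open>The derivative is a polynomial in \<open>inverse\<close> itself, so each order of
  smoothness yields the next.\<close>

lemma smooth_on_inverse_real: "smooth_on (- {0}) (inverse :: real \<Rightarrow> real)"
  unfolding smooth_on_def
proof
  have S: "open (- {0::real})" by auto
  show "Ck_on k (- {0}) (inverse :: real \<Rightarrow> real)" for k
  proof (induction k)
    case 0
    show ?case by (auto intro!: continuous_intros)
  next
    case (Suc k)
    show ?case
    proof (rule Ck_on_SucI_real[OF S])
      show "(inverse has_real_derivative (-1) * (inverse x * inverse x)) (at x)" if "x \<in> - {0}" for x :: real
        using that DERIV_inverse[of x UNIV] by (simp add: power2_eq_square)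
      show "Ck_on k (- {0}) (\<lambda>x::real. (-1) * (inverse x * inverse x))"
        by (intro Ck_on_mult Ck_on_const S Suc)
    qed
  qed
qed

lemma smooth_on_inverse:
  fixes f :: "'a::euclidean_space \<Rightarrow> real"
  assumes "open S" "smooth_on S f" "\<And>x. x \<in> S \<Longrightarrow> f x \<noteq> 0"
  shows "smooth_on S (\<lambda>x. inverse (f x))"
  by (rule smooth_on_compose[OF assms(1) _ _ smooth_on_inverse_real assms(2)]) (use assms(3) in auto)

lemma smooth_on_divide:
  fixes f h :: "'a::euclidean_space \<Rightarrow> real"
  assumes "open S" "smooth_on S f" "smooth_on S h" "\<And>x. x \<in> S \<Longrightarrow> h x \<noteq> 0"
  shows "smooth_on S (\<lambda>x. f x / h x)"
  unfolding divide_inverse by (intro smooth_on_mult smooth_on_inverse assms)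

text \<open>The derivative is half of \<open>inverse\<close> composed with \<open>sqrt\<close>, so
  the induction hypothesis for \<open>sqrt\<close> and the smoothness of \<open>inverse\<close> give
  the next order.\<close>

lemma smooth_on_sqrt_real: "smooth_on {0<..} sqrt"
  unfolding smooth_on_def
proof
  have S: "open {0::real<..}" by auto
  show "Ck_on k {0<..} sqrt" for k
  proof (induction k)
    case 0
    show ?case by (auto intro!: continuous_intros)
  next
    case (Suc k)
    show ?case
    proof (rule Ck_on_SucI_real[OF S])
      show "(sqrt has_real_derivative inverse (sqrt x) * (1/2)) (at x)" if "x \<in> {0<..}" for x :: real
        using that DERIV_real_sqrt[of x] by (simp add: field_simps)
      have "Ck_on k {0<..} (\<lambda>x. inverse (sqrt x))"
        using smooth_on_inverse_real unfolding smooth_on_def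
        by (intro Ck_on_compose[OF S, of "- {0}" sqrt k inverse] Suc) auto
      then show "Ck_on k {0<..} (\<lambda>x. inverse (sqrt x) * (1/2))"
        by (intro Ck_on_mult Ck_on_const S)
    qed
  qed
qed

lemma smooth_on_sqrt:
  fixes f :: "'a::euclidean_space \<Rightarrow> real"
  assumes "open S" "smooth_on S f" "\<And>x. x \<in> S \<Longrightarrow> f x > 0"
  shows "smooth_on S (\<lambda>x. sqrt (f x))"
  by (rule smooth_on_compose[OF assms(1) _ _ smooth_on_sqrt_real assms(2)]) (use assms(3) in auto)

text \<open>It suits functions such as \<open>arccos\<close>, whose derivative is an expression in
  functions already known to be smooth.\<close>

lemma smooth_on_integrate:
  fixes f :: "real \<Rightarrow> real"
  assumes "open S" "\<And>x. x \<in> S \<Longrightarrow> (f has_real_derivative f' x) (at x)" "smooth_on S f'"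
  shows "smooth_on S f"
  using Ck_on_SucI_real[OF assms(1,2)] assms(3) unfolding smooth_on_def by (metis Ck_on_SucD)

lemma smooth_on_arccos:
  fixes f :: "'a::euclidean_space \<Rightarrow> real"
  assumes "open S" "smooth_on S f" "\<And>x. x \<in> S \<Longrightarrow> \<bar>f x\<bar> < 1"
  shows "smooth_on S (\<lambda>x. arccos (f x))"
proof (rule smooth_on_compose[OF assms(1) _ _ _ assms(2)])
  have S: "open {-1::real<..<1}" by auto
  \<comment> \<open>Written with \<open>+\<close>, unary minus and products so that the closure
    rules for smooth functions apply to it literally.\<close>
  have pos: "0 < 1 + - (x * x)" if "x \<in> {-1<..<1}" for x :: real
    using that abs_square_less_1[of x] by (auto simp: power2_eq_square)
  show "smooth_on {-1<..<1} arccos"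
  proof (rule smooth_on_integrate[OF S])
    show "(arccos has_real_derivative - inverse (sqrt (1 + - (x * x)))) (at x)" if "x \<in> {-1<..<1}" for x
      using DERIV_arccos[of x] that by (simp add: power2_eq_square)
    show "smooth_on {- 1<..<1} (\<lambda>x. - inverse (sqrt (1 + - (x * x))))"
      using pos less_imp_neq[OF pos]
      by (intro smooth_on_uminus smooth_on_inverse smooth_on_sqrt smooth_on_add smooth_on_mult smooth_on_const smooth_on_ident S)
        fastforce+
  qed
qed (use assms(3) in \<open>auto simp: abs_less_iff\<close>)

text \<open>The induction runs over both functions at once, since each is the derivative of the
  other up to sign.\<close>

lemma smooth_on_sin_cos_real: "smooth_on UNIV (sin :: real \<Rightarrow> real)" "smooth_on UNIV (cos :: real \<Rightarrow> real)"
proof -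
  have "Ck_on k UNIV (sin :: real \<Rightarrow> real) \<and> Ck_on k UNIV (cos :: real \<Rightarrow> real)" for k
  proof (induction k)
    case 0
    show ?case by (auto intro!: continuous_intros)
  next
    case (Suc k)
    have "Ck_on k UNIV (\<lambda>x::real. (-1) * sin x)" using Suc by (intro Ck_on_mult Ck_on_const) auto
    then show ?case using Suc
      by (auto simp del: Ck_on.simps intro!: Ck_on_SucI_real derivative_eq_intros)
  qed
  then show "smooth_on UNIV (sin :: real \<Rightarrow> real)" "smooth_on UNIV (cos :: real \<Rightarrow> real)"
    by (auto simp: smooth_on_def)
qed

lemma smooth_on_sin:
  fixes f :: "'a::euclidean_space \<Rightarrow> real"
  shows "open S \<Longrightarrow> smooth_on S f \<Longrightarrow> smooth_on S (\<lambda>x. sin (f x))"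
  by (rule smooth_on_compose[OF _ _ _ smooth_on_sin_cos_real(1)]) auto

lemma smooth_on_cos:
  fixes f :: "'a::euclidean_space \<Rightarrow> real"
  shows "open S \<Longrightarrow> smooth_on S f \<Longrightarrow> smooth_on S (\<lambda>x. cos (f x))"
  by (rule smooth_on_compose[OF _ _ _ smooth_on_sin_cos_real(2)]) auto

section \<open>Bump functions from the flat exponential\<close>

definition flat_exp :: "nat \<Rightarrow> real \<Rightarrow> real"
  where "flat_exp n x = (if x \<le> 0 then 0 else inverse x ^ n * exp (- inverse x))"

text \<open>From the right, the substitution y = 1/x turns the claim into the decay of y^n / exp y
  at infinity.\<close>

lemma flat_exp_tendsto: "(flat_exp n \<longlongrightarrow> 0) (at 0)"
proof (rule filterlim_split_at)
  show "(flat_exp n \<longlongrightarrow> 0) (at_left 0)"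
    by (rule tendsto_eventually) (auto simp: eventually_at_filter flat_exp_def)
  have "((\<lambda>x::real. x ^ n / exp x) \<longlongrightarrow> 0) at_top" by (rule tendsto_power_div_exp_0)
  then have "((\<lambda>x::real. inverse x ^ n / exp (inverse x)) \<longlongrightarrow> 0) (at_right 0)"
    by (rule filterlim_compose) (rule filterlim_inverse_at_top_right)
  then show "(flat_exp n \<longlongrightarrow> 0) (at_right 0)"
    by (rule Lim_transform_eventually, intro eventually_mono[OF eventually_at_right_less])
       (simp add: flat_exp_def exp_minus divide_inverse)
qed

text \<open>With y = 1/x, the chain rule multiplies the derivative of y^n exp(-y) by -y^2, which
  gives members of the same family. This closure under differentiation is the reason for carrying
  the parameter \<open>n\<close>, although the bump uses only \<open>flat_exp 0\<close>.\<close>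

lemma flat_exp_deriv:
  "(flat_exp n has_real_derivative (flat_exp (n + 2) x + (- real n) * flat_exp (n + 1) x)) (at x)"
proof -
  consider "x < 0" | "x = 0" | "x > 0" by linarith
  then show ?thesis
  proof cases
    case 1
    have "(flat_exp n has_real_derivative 0) (at x)"
      by (rule has_field_derivative_transform_within_open[of "\<lambda>x. 0" _ _ "{..<0}"])
         (use 1 in \<open>auto simp: flat_exp_def\<close>)
    then show ?thesis using 1 by (simp add: flat_exp_def)
  next
    case 2
    \<comment> \<open>Off zero the difference quotient at 0 is exactly
      \<open>flat_exp (Suc n)\<close>.\<close>
    have "((\<lambda>h. (flat_exp n (0 + h) - flat_exp n 0) / h) \<longlongrightarrow> 0) (at 0)"
      by (rule Lim_transform_eventually[OF flat_exp_tendsto[of "Suc n"]])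
         (auto simp: eventually_at_filter flat_exp_def divide_inverse)
    then have "(flat_exp n has_real_derivative 0) (at 0)" by (simp add: DERIV_def)
    then show ?thesis using 2 by (simp add: flat_exp_def)
  next
    case 3
    have y: "(inverse has_real_derivative - (inverse x)\<^sup>2) (at x)"
      using 3 DERIV_inverse[of x UNIV] by (simp add: numeral_2_eq_2)
    \<comment> \<open>The subtraction in \<open>n - 1\<close> truncates at \<open>n = 0\<close>,
      where the factor \<open>real n\<close> removes the term; hence the case split.\<close>
    have eq: "(real n * inverse x ^ (n - 1) * exp (- inverse x) - inverse x ^ n * exp (- inverse x))
        * (- (inverse x)\<^sup>2) = flat_exp (n + 2) x + (- real n) * flat_exp (n + 1) x"
      using 3 by (cases n) (simp_all add: flat_exp_def algebra_simps power2_eq_square)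
    have "((\<lambda>y. y ^ n * exp (- y)) has_real_derivative
        real n * inverse x ^ (n - 1) * exp (- inverse x) - inverse x ^ n * exp (- inverse x))
        (at (inverse x))"
      by (auto intro!: derivative_eq_intros simp: algebra_simps)
    from DERIV_chain2[OF this y]
    have "((\<lambda>x. inverse x ^ n * exp (- inverse x)) has_real_derivative
        (flat_exp (n + 2) x + (- real n) * flat_exp (n + 1) x)) (at x)"
      unfolding eq .
    then show ?thesis
      by (rule has_field_derivative_transform_within_open[of _ _ _ "{0<..}"])
         (use 3 in \<open>auto simp: flat_exp_def\<close>)
  qed
qed

lemma smooth_on_flat_exp: "smooth_on UNIV (flat_exp n)"
proof -
  have "Ck_on k UNIV (flat_exp n)" for k
  proof (induction k arbitrary: n)
    case 0
    show ?case by (auto intro!: continuous_at_imp_continuous_on DERIV_continuous[OF flat_exp_deriv])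
  next
    case (Suc k)
    show ?case
      by (rule Ck_on_SucI_real[OF open_UNIV flat_exp_deriv])
         (intro Ck_on_add Ck_on_mult Ck_on_const open_UNIV Suc)
  qed
  then show ?thesis by (simp add: smooth_on_def)
qed

lemma smooth_bump:
  fixes z :: "'e::euclidean_space"
  assumes "r > 0"
  obtains b where "smooth_on UNIV b" "b z = (1::real)" "\<And>y. y \<notin> cball z r \<Longrightarrow> b y = 0"
proof
  \<comment> \<open>The argument is positive exactly inside the ball. The squared distance is used
    because, unlike the norm, it is smooth at the centre as well; the denominator normalises the
    value at \<open>z\<close> to 1.\<close>
  define b where "b y = flat_exp 0 (r\<^sup>2 - (y - z) \<bullet> (y - z)) / flat_exp 0 (r\<^sup>2)" for y
  have "smooth_on UNIV (\<lambda>y. (y + - z) \<bullet> (y + - z))"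
    using smooth_on_add[OF _ smooth_on_ident smooth_on_const, of UNIV "- z"]
    unfolding smooth_on_def by (auto intro: Ck_on_bilinear[OF bounded_bilinear_inner])
  then have "smooth_on UNIV (\<lambda>y. flat_exp 0 (r\<^sup>2 + - ((y + - z) \<bullet> (y + - z))))"
    by (intro smooth_on_compose[OF _ _ _ smooth_on_flat_exp] smooth_on_add smooth_on_const smooth_on_uminus)
       auto
  then have "smooth_on UNIV (\<lambda>y. flat_exp 0 (r\<^sup>2 + - ((y + - z) \<bullet> (y + - z))) / flat_exp 0 (r\<^sup>2))"
    unfolding divide_inverse by (intro smooth_on_mult smooth_on_const) auto
  then show "smooth_on UNIV b" unfolding b_def by simp
  show "b z = 1" using assms by (simp add: b_def flat_exp_def)
  show "b y = 0" if "y \<notin> cball z r" for y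
  proof -
    have "r\<^sup>2 < (norm (y - z))\<^sup>2"
      using that assms by (intro power_strict_mono) (auto simp: dist_norm norm_minus_commute)
    then show ?thesis by (simp add: b_def flat_exp_def dot_square_norm)
  qed
qed

section \<open>Smooth functions and fields on manifolds\<close>

lemma smooth_atlas_chartD:
  assumes "smooth_atlas A" "(U, x) \<in> A"
  shows "open U" "open (x ` U)" "homeomorphism U (x ` U) x (inv_into U x)" "inj_on x U"
  using assms unfolding smooth_atlas_def chart_def homeomorphism_def by (force intro: inj_on_inverseI)+

lemma open_chart_image:
  assumes "smooth_atlas A" "(U, x) \<in> A" "open W" "W \<subseteq> U"
  shows "open (x ` W)"
proof -
  have "openin (top_of_set U) W" using assms(3,4) by (auto simp: openin_open)
  then have "openin (top_of_set (x ` U)) (x ` W)"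
    using homeomorphism_imp_open_map[OF smooth_atlas_chartD(3)[OF assms(1,2)]] by blast
  then show ?thesis using openin_open_trans smooth_atlas_chartD(2)[OF assms(1,2)] by blast
qed

lemma chart_at:
  assumes "smooth_atlas A"
  obtains U x where "(U, x) \<in> A" "p \<in> U"
  using assms unfolding smooth_atlas_def by blast

lemma smooth_funD: "smooth_fun A h \<Longrightarrow> (U, x) \<in> A \<Longrightarrow> smooth_on (x ` U) (h \<circ> inv_into U x)"
  unfolding smooth_fun_def by blast

lemma smooth_funI:
  "(\<And>U x. (U, x) \<in> A \<Longrightarrow> smooth_on (x ` U) (\<lambda>z. h (inv_into U x z))) \<Longrightarrow> smooth_fun A h"
  unfolding smooth_fun_def comp_def by blast

lemma smooth_fun_const: "smooth_atlas A \<Longrightarrow> smooth_fun A (\<lambda>q. c)"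
  using smooth_atlas_chartD(2) by (intro smooth_funI smooth_on_const)

lemma smooth_fun_add: "smooth_atlas A \<Longrightarrow> smooth_fun A h \<Longrightarrow> smooth_fun A k \<Longrightarrow> smooth_fun A (\<lambda>q. h q + k q)"
  by (intro smooth_funI smooth_on_add smooth_atlas_chartD(2)) (auto dest: smooth_funD simp: comp_def)

lemma smooth_fun_mult: "smooth_atlas A \<Longrightarrow> smooth_fun A h \<Longrightarrow> smooth_fun A k \<Longrightarrow> smooth_fun A (\<lambda>q. h q * k q)"
  by (intro smooth_funI smooth_on_mult smooth_atlas_chartD(2)) (auto dest: smooth_funD simp: comp_def)

text \<open>Away from the support the function vanishes, and the complement of the support is open
  because compact sets are closed in a Hausdorff space.\<close>

lemma smooth_fun_compact_support:
  assumes A: "smooth_atlas A" and U: "(U, x) \<in> A"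
    and K: "compact K" "K \<subseteq> x ` U"
    and sm: "smooth_on (x ` U) (F \<circ> inv_into U x)"
    and zero: "\<And>q. q \<in> U \<Longrightarrow> x q \<notin> K \<Longrightarrow> F q = 0" "\<And>q. q \<notin> U \<Longrightarrow> F q = 0"
  shows "smooth_fun A F"
proof (rule smooth_funI)
  fix V y assume V: "(V, y) \<in> A"
  define C where "C = inv_into U x ` K"
  note ch = smooth_atlas_chartD[OF A U] and chV = smooth_atlas_chartD[OF A V]
  have "continuous_on K (inv_into U x)"
    using continuous_on_subset[OF homeomorphism_cont2[OF ch(3)] K(2)] .
  then have "closed C" unfolding C_def using K(1) by (intro compact_imp_closed compact_continuous_image)
  have FC: "F q = 0" if "q \<notin> C" for q
  proof (cases "q \<in> U")
    case True
    then have "inv_into U x (x q) = q" using ch(4) by simp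
    then have "x q \<notin> K" using that imageI[of "x q" K "inv_into U x"] unfolding C_def by auto
    then show ?thesis by (rule zero(1)[OF True])
  qed (rule zero(2))
  have trans: "smooth_on (y ` (V \<inter> U)) (x \<circ> inv_into V y)"
  proof -
    have "\<forall>c\<in>A. \<forall>d\<in>A. smooth_on (snd c ` (fst c \<inter> fst d)) (snd d \<circ> inv_into (fst c) (snd c))"
      using A unfolding smooth_atlas_def by (simp add: case_prod_beta)
    from this[rule_format, OF V U] show ?thesis by simp
  qed
  have inv: "inv_into V y (y q) = q" if "q \<in> V" for q using that chV(4) by simp
  show "smooth_on (y ` V) (\<lambda>z. F (inv_into V y z))"
  proof (rule smooth_on_local)
    fix z assume "z \<in> y ` V"
    then obtain q where q: "q \<in> V" "z = y q" by blast
    show "\<exists>W. open W \<and> z \<in> W \<and> W \<subseteq> y ` V \<and> smooth_on W (\<lambda>z. F (inv_into V y z))"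
    proof (cases "q \<in> U")
      case True
      let ?W = "y ` (V \<inter> U)"
      have o: "open ?W" using chV(1) ch(1) by (intro open_chart_image[OF A V]) auto
      have "smooth_on ?W (\<lambda>z. (F \<circ> inv_into U x) ((x \<circ> inv_into V y) z))"
        by (rule smooth_on_compose[OF o ch(2) _ sm trans]) (auto simp: inv)
      then have "smooth_on ?W (\<lambda>z. F (inv_into V y z))"
        by (rule smooth_on_cong[OF o]) (auto simp: inv ch(4))
      moreover have "z \<in> ?W" "?W \<subseteq> y ` V" using q True by auto
      ultimately show ?thesis using o by (intro exI[of _ ?W] conjI)
    next
      case False
      let ?W = "y ` (V - C)"
      have o: "open ?W" using chV(1) \<open>closed C\<close> by (intro open_chart_image[OF A V]) auto
      have "smooth_on ?W (\<lambda>z. F (inv_into V y z))"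
        by (rule smooth_on_cong[OF o smooth_on_const[OF o, of 0]]) (auto simp: inv FC)
      moreover have "C \<subseteq> U" using K(2) homeomorphism_image2[OF ch(3)] unfolding C_def by blast
      then have "z \<in> ?W" "?W \<subseteq> y ` V" using False q by auto
      ultimately show ?thesis using o by (intro exI[of _ ?W] conjI)
    qed
  qed
qed

section \<open>Curves in charts and extension of their velocity\<close>

lemma smooth_curve_chart:
  assumes "smooth_atlas A" "smooth_curve A I \<gamma>" "open I" "(U, x) \<in> A"
  shows "open {t\<in>I. \<gamma> t \<in> U}" "smooth_on {t\<in>I. \<gamma> t \<in> U} (x \<circ> \<gamma>)"
proof -
  have "open (\<gamma> -` U \<inter> I)"
    using assms continuous_on_open_vimage[of I \<gamma>] smooth_atlas_chartD(1)[OF assms(1,4)]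
    unfolding smooth_curve_def by blast
  then show "open {t\<in>I. \<gamma> t \<in> U}" by (simp add: vimage_def Int_def conj_commute)
  show "smooth_on {t\<in>I. \<gamma> t \<in> U} (x \<circ> \<gamma>)" using assms(2,4) unfolding smooth_curve_def by blast
qed

lemma smooth_fun_along_curve:
  assumes "smooth_atlas A" "smooth_curve A I \<gamma>" "open I" "smooth_fun A h"
  shows "smooth_on I (\<lambda>t. h (\<gamma> t))"
proof (rule smooth_on_local)
  fix t assume t: "t \<in> I"
  obtain U x where U: "(U, x) \<in> A" "\<gamma> t \<in> U" using chart_at[OF assms(1)] .
  note ch = smooth_atlas_chartD[OF assms(1) U(1)] and cu = smooth_curve_chart[OF assms(1-3) U(1)]
  have "smooth_on {t\<in>I. \<gamma> t \<in> U} (\<lambda>t. (h \<circ> inv_into U x) ((x \<circ> \<gamma>) t))"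
    by (rule smooth_on_compose[OF cu(1) ch(2) _ smooth_funD[OF assms(4) U(1)] cu(2)]) auto
  then have "smooth_on {t\<in>I. \<gamma> t \<in> U} (\<lambda>t. h (\<gamma> t))"
    by (rule smooth_on_cong[OF cu(1)]) (use ch(4) in auto)
  then show "\<exists>W. open W \<and> t \<in> W \<and> W \<subseteq> I \<and> smooth_on W (\<lambda>t. h (\<gamma> t))"
    using cu(1) t U(2) by (intro exI[of _ "{t\<in>I. \<gamma> t \<in> U}"]) auto
qed

text \<open>The extension is a cut-off of the field with constant coefficients in a chart.\<close>

lemma velocity_extends_to_vector_field:
  fixes A :: "('m::{t2_space, second_countable_topology}, 'e::euclidean_space) chart set"
  assumes A: "smooth_atlas A" and \<gamma>: "smooth_curve A I \<gamma>" "open I" and t: "t \<in> I"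
  shows "\<exists>X. vector_field A X \<and> X (\<gamma> t) = velocity A \<gamma> t"
proof -
  obtain U x where U: "(U, x) \<in> A" "\<gamma> t \<in> U" using chart_at[OF A] .
  note ch = smooth_atlas_chartD[OF A U(1)] and cu = smooth_curve_chart[OF A \<gamma> U(1)]
  have inv: "inv_into U x (x q) = q" if "q \<in> U" for q using that ch(4) by simp
  obtain r where r: "r > 0" "cball (x (\<gamma> t)) r \<subseteq> x ` U"
    using ch(2) U(2) open_contains_cball by blast
  obtain b :: "'e \<Rightarrow> real" where b: "smooth_on UNIV b" "b (x (\<gamma> t)) = 1"
      "\<And>y. y \<notin> cball (x (\<gamma> t)) r \<Longrightarrow> b y = 0"
    using smooth_bump[OF r(1)] by blast
  \<comment> \<open>\<open>c\<close> is the velocity in chart coordinates and \<open>d h\<close> the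
    derivative of \<open>h\<close> in this fixed direction. The test for
    \<open>smooth_fun A h\<close> in \<open>X\<close> supplies the value 0 that tangent vectors have
    on all other functions.\<close>
  define c where "c = frechet_derivative (x \<circ> \<gamma>) (at t) 1"
  define d where "d h z = frechet_derivative (h \<circ> inv_into U x) (at z) c" for h :: "'m \<Rightarrow> real" and z
  define X where "X q h = (if q \<in> U \<and> smooth_fun A h then b (x q) * d h (x q) else 0)" for q h
  have der: "((h \<circ> inv_into U x) has_derivative frechet_derivative (h \<circ> inv_into U x) (at (x q))) (at (x q))"
    if "smooth_fun A h" "q \<in> U" for h q
    using smooth_on_has_derivative[OF smooth_funD[OF that(1) U(1)] ch(2)] that(2) by blast
  have d_add: "d (\<lambda>q. h q + k q) (x q) = d h (x q) + d k (x q)"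
    if "smooth_fun A h" "smooth_fun A k" "q \<in> U" for h k q
    using frechet_derivative_at[OF has_derivative_add[OF der[OF that(1,3)] der[OF that(2,3)]]]
    unfolding d_def comp_def by metis
  have d_mult: "d (\<lambda>q. h q * k q) (x q) = h q * d k (x q) + k q * d h (x q)"
    if "smooth_fun A h" "smooth_fun A k" "q \<in> U" for h k q
    using frechet_derivative_at[OF has_derivative_mult[OF der[OF that(1,3)] der[OF that(2,3)]], symmetric]
    unfolding d_def comp_def by (simp add: inv that(3) mult.commute)
  have d_scale: "d (\<lambda>q. a * h q) (x q) = a * d h (x q)" if "smooth_fun A h" "q \<in> U" for a h q
    using frechet_derivative_at[OF has_derivative_mult_right[OF der[OF that], of a], symmetric]
    unfolding d_def comp_def by simp
  have "X q \<in> tangent_space A q" for q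
  proof -
    have "X q (\<lambda>q. h q + k q) = X q h + X q k" "X q (\<lambda>q. h q * k q) = h q * X q k + k q * X q h"
      if "smooth_fun A h" "smooth_fun A k" for h k
      using d_add[OF that] d_mult[OF that] smooth_fun_add[OF A that] smooth_fun_mult[OF A that] that
      by (auto simp: X_def algebra_simps)
    moreover have "X q (\<lambda>q. a * h q) = a * X q h" if "smooth_fun A h" for a h
      using d_scale[OF that] smooth_fun_mult[OF A smooth_fun_const[OF A] that] that by (auto simp: X_def)
    ultimately show ?thesis unfolding tangent_space_def by (auto simp: X_def)
  qed
  moreover have "smooth_fun A (\<lambda>q. X q h)" if h: "smooth_fun A h" for h
  \<comment> \<open>The cut-off confines the function to the preimage of a closed ball inside the
    chart image, so extension by zero remains smooth.\<close>
  proof (rule smooth_fun_compact_support[OF A U(1) compact_cball r(2)])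
    have "smooth_on (x ` U) (\<lambda>z. b z * d h z)"
      unfolding d_def using smooth_funD[OF h U(1)] b(1)
      by (intro smooth_on_mult ch(2) smooth_on_frechet_derivative) (auto intro: smooth_on_subset)
    then show "smooth_on (x ` U) ((\<lambda>q. X q h) \<circ> inv_into U x)"
      by (rule smooth_on_cong[OF ch(2)]) (auto simp: X_def h inv)
  qed (auto simp: X_def b(3))
  ultimately have "vector_field A X" unfolding vector_field_def by blast
  moreover have "X (\<gamma> t) h = velocity A \<gamma> t h" for h
  proof (cases "smooth_fun A h")
    case True
    \<comment> \<open>The derivative of \<open>h\<close> along the curve is computed twice, by the
      chain rule through the chart and as \<open>deriv\<close>; comparison identifies
      \<open>X\<close> at \<open>\<gamma> t\<close> with the velocity, because \<open>b\<close> is 1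
      there.\<close>
    have "((x \<circ> \<gamma>) has_derivative frechet_derivative (x \<circ> \<gamma>) (at t)) (at t)"
      using smooth_on_has_derivative[OF cu(2,1)] t U(2) by blast
    from has_derivative_compose[OF this, of "h \<circ> inv_into U x"] der[OF True U(2)]
    have *: "((\<lambda>\<tau>. (h \<circ> inv_into U x) ((x \<circ> \<gamma>) \<tau>)) has_derivative
        (\<lambda>s. frechet_derivative (h \<circ> inv_into U x) (at (x (\<gamma> t))) (frechet_derivative (x \<circ> \<gamma>) (at t) s))) (at t)"
      by simp
    have "((\<lambda>\<tau>. h (\<gamma> \<tau>)) has_derivative
        (\<lambda>s. frechet_derivative (h \<circ> inv_into U x) (at (x (\<gamma> t))) (frechet_derivative (x \<circ> \<gamma>) (at t) s))) (at t)"
      by (rule has_derivative_transform_within_open[OF * cu(1)]) (use t U(2) inv in auto)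
    from frechet_derivative_at[OF this]
    have "frechet_derivative (\<lambda>\<tau>. h (\<gamma> \<tau>)) (at t) 1 = d h (x (\<gamma> t))"
      unfolding d_def c_def by metis
    moreover have "((\<lambda>\<tau>. h (\<gamma> \<tau>)) has_derivative (\<lambda>s. deriv (\<lambda>\<tau>. h (\<gamma> \<tau>)) t * s)) (at t)"
      using smooth_on_has_real_derivative[OF smooth_fun_along_curve[OF A \<gamma> True] \<gamma>(2) t]
      by (simp add: has_field_derivative_def)
    from frechet_derivative_at[OF this]
    have "frechet_derivative (\<lambda>\<tau>. h (\<gamma> \<tau>)) (at t) 1 = deriv (\<lambda>\<tau>. h (\<gamma> \<tau>)) t"
      by (metis mult.right_neutral)
    ultimately show ?thesis using True U(2) b(2) by (simp add: X_def velocity_def)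
  qed (simp add: X_def velocity_def)
  ultimately show ?thesis by blast
qed

section \<open>Algebra of tangent vectors, fields along a curve and their covariant
  derivatives\<close>

lemma tangent_space_add: "smooth_atlas A \<Longrightarrow> u \<in> tangent_space A p \<Longrightarrow> v \<in> tangent_space A p \<Longrightarrow> u + v \<in> tangent_space A p"
  unfolding tangent_space_def by (simp add: algebra_simps)

lemma tangent_space_scaleR: "u \<in> tangent_space A p \<Longrightarrow> c *\<^sub>R u \<in> tangent_space A p"
  unfolding tangent_space_def by (simp add: algebra_simps scaleR_fun_def)

lemma tangent_space_zero: "0 \<in> tangent_space A p"
  unfolding tangent_space_def by simp

lemma tangent_space_uminus: "u \<in> tangent_space A p \<Longrightarrow> - u \<in> tangent_space A p"
  using tangent_space_scaleR[of u A p "-1"] by simp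

lemma tangent_space_sum:
  "smooth_atlas A \<Longrightarrow> (\<And>i. i \<in> J \<Longrightarrow> v i \<in> tangent_space A p) \<Longrightarrow> (\<Sum>i\<in>J. v i) \<in> tangent_space A p"
  by (induction J rule: infinite_finite_induct) (auto intro: tangent_space_add tangent_space_zero)

lemma field_alongD: "field_along A I \<gamma> V \<Longrightarrow> t \<in> I \<Longrightarrow> V t \<in> tangent_space A (\<gamma> t)"
  unfolding field_along_def by blast

text \<open>Fields along the curve are functions on the whole real line, and equations such as the
  Frenet equations identify them on \<open>I\<close> only; this transfers the regularity across such
  equations.\<close>

lemma field_along_cong:
  assumes "open I" "field_along A I \<gamma> V" "\<And>t. t \<in> I \<Longrightarrow> V t = W t"
  shows "field_along A I \<gamma> W"
proof -
  have "smooth_on I (\<lambda>t. W t h)" if "smooth_fun A h" for h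
    by (rule smooth_on_cong[OF assms(1), of "\<lambda>t. V t h"]) (use assms that in \<open>auto simp: field_along_def\<close>)
  then show ?thesis using assms(2,3) unfolding field_along_def by metis
qed

lemma field_along_zero: "open I \<Longrightarrow> field_along A I \<gamma> (\<lambda>t. 0)"
  unfolding field_along_def by (simp add: tangent_space_zero smooth_on_const)

lemma field_along_add:
  "smooth_atlas A \<Longrightarrow> open I \<Longrightarrow> field_along A I \<gamma> V \<Longrightarrow> field_along A I \<gamma> W \<Longrightarrow> field_along A I \<gamma> (\<lambda>t. V t + W t)"
  unfolding field_along_def by (simp add: tangent_space_add smooth_on_add)

lemma field_along_scaleR:
  "open I \<Longrightarrow> smooth_on I u \<Longrightarrow> field_along A I \<gamma> V \<Longrightarrow> field_along A I \<gamma> (\<lambda>t. u t *\<^sub>R V t)"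
  unfolding field_along_def
proof (elim conjE, intro conjI ballI allI impI)
  fix t assume "\<forall>t\<in>I. V t \<in> tangent_space A (\<gamma> t)" "t \<in> I"
  then show "u t *\<^sub>R V t \<in> tangent_space A (\<gamma> t)" by (intro tangent_space_scaleR) blast
qed (simp add: scaleR_fun_def smooth_on_mult)

lemma field_along_sum:
  "smooth_atlas A \<Longrightarrow> open I \<Longrightarrow> (\<And>i. i \<in> J \<Longrightarrow> field_along A I \<gamma> (V i)) \<Longrightarrow> field_along A I \<gamma> (\<lambda>t. \<Sum>i\<in>J. V i t)"
  by (induction J rule: infinite_finite_induct) (simp_all add: field_along_add field_along_zero)

lemma vector_field_along_curve:
  assumes "smooth_atlas A" "smooth_curve A I \<gamma>" "open I" "vector_field A Y"
  shows "field_along A I \<gamma> (\<lambda>t. Y (\<gamma> t))"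
  using assms smooth_fun_along_curve[OF assms(1-3)] unfolding field_along_def vector_field_def by blast

lemma cov_deriv_along_cong:
  assumes "cov_deriv_along A nabla I \<gamma> D" "field_along A I \<gamma> V" "field_along A I \<gamma> W"
    and "\<And>t. t \<in> I \<Longrightarrow> V t = W t" "t \<in> I"
  shows "D V t = D W t"
  using assms(1)[unfolded cov_deriv_along_def, THEN conjunct2, THEN conjunct1, rule_format, OF assms(2,3)]
    assms(4,5) by blast

lemma cov_deriv_along_add:
  assumes "cov_deriv_along A nabla I \<gamma> D" "field_along A I \<gamma> V" "field_along A I \<gamma> W" "t \<in> I"
  shows "D (\<lambda>t. V t + W t) t = D V t + D W t"
proof -
  have "D (V + W) t = D V t + D W t"
    using assms(1)[unfolded cov_deriv_along_def, THEN conjunct2, THEN conjunct2, THEN conjunct1,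
        rule_format, OF assms(2-4)] .
  then show ?thesis by (simp add: plus_fun_def)
qed

lemma cov_deriv_along_scaleR:
  assumes "cov_deriv_along A nabla I \<gamma> D" "smooth_on I u" "field_along A I \<gamma> V" "t \<in> I"
  shows "D (\<lambda>t. u t *\<^sub>R V t) t = deriv u t *\<^sub>R V t + u t *\<^sub>R D V t"
  using assms(1)[unfolded cov_deriv_along_def, THEN conjunct2, THEN conjunct2, THEN conjunct2, THEN conjunct1,
      rule_format, OF assms(2-4)] .

lemma cov_deriv_along_sum:
  assumes "cov_deriv_along A nabla I \<gamma> D" "smooth_atlas A" "open I"
    and "\<And>i. i \<in> J \<Longrightarrow> field_along A I \<gamma> (V i)" "t \<in> I"
  shows "D (\<lambda>t. \<Sum>i\<in>J. V i t) t = (\<Sum>i\<in>J. D (V i) t)"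
proof -
  \<comment> \<open>Additivity gives D 0 = D 0 + D 0. This settles both the empty and the infinite
    index set.\<close>
  have zero: "D (\<lambda>t. 0) t = 0"
    using cov_deriv_along_add[OF assms(1) field_along_zero[OF assms(3)] field_along_zero[OF assms(3)] assms(5)]
    by simp
  show ?thesis
    using assms(4)
  proof (induction J rule: infinite_finite_induct)
    case (insert i J)
    then have "D (\<lambda>t. V i t + (\<Sum>i\<in>J. V i t)) t = D (V i) t + D (\<lambda>t. \<Sum>i\<in>J. V i t) t"
      by (intro cov_deriv_along_add[OF assms(1)] field_along_sum assms(2,3,5)) auto
    moreover have "(\<lambda>t. \<Sum>i\<in>insert i J. V i t) = (\<lambda>t. V i t + (\<Sum>i\<in>J. V i t))"
      by (simp only: sum.insert[OF insert.hyps])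
    moreover have "D (\<lambda>t. \<Sum>i\<in>J. V i t) t = (\<Sum>i\<in>J. D (V i) t)" using insert by blast
    ultimately show ?case by (simp only: sum.insert[OF insert.hyps])
  qed (simp_all add: zero)
qed

lemma cov_deriv_along_vector_field:
  assumes "cov_deriv_along A nabla I \<gamma> D" "vector_field A X" "vector_field A Y" "t \<in> I"
    and "X (\<gamma> t) = velocity A \<gamma> t"
  shows "D (\<lambda>t. Y (\<gamma> t)) t = nabla X Y (\<gamma> t)"
  using assms(1)[unfolded cov_deriv_along_def, THEN conjunct2, THEN conjunct2, THEN conjunct2, THEN conjunct2,
      rule_format, OF assms(2-5)] .

section \<open>Covariant derivatives of the structure vector fields\<close>

lemma linear_at_add: "linear_at A p L \<Longrightarrow> u \<in> tangent_space A p \<Longrightarrow> v \<in> tangent_space A p \<Longrightarrow> L (u + v) = L u + L v"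
  unfolding linear_at_def by blast

lemma linear_at_scaleR: "linear_at A p L \<Longrightarrow> u \<in> tangent_space A p \<Longrightarrow> L (c *\<^sub>R u) = c *\<^sub>R L u"
  unfolding linear_at_def by blast

lemma linear_at_zero: "linear_at A p L \<Longrightarrow> L 0 = 0"
  using linear_at_scaleR[of A p L 0 0, OF _ tangent_space_zero] by simp

lemma linear_at_uminus: "linear_at A p L \<Longrightarrow> u \<in> tangent_space A p \<Longrightarrow> L (- u) = - L u"
  using linear_at_scaleR[of A p L u "-1"] by simp

lemma linear_at_diff:
  "linear_at A p L \<Longrightarrow> u \<in> tangent_space A p \<Longrightarrow> v \<in> tangent_space A p \<Longrightarrow> L (u - v) = L u - L v"
  using linear_at_add[of A p L u "- v"] linear_at_uminus[of A p L v] tangent_space_uminus[of v A p] by simp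

lemma linear_at_sum:
  assumes "linear_at A p L" "smooth_atlas A" "\<And>i. i \<in> J \<Longrightarrow> v i \<in> tangent_space A p"
  shows "L (\<Sum>i\<in>J. v i) = (\<Sum>i\<in>J. L (v i))"
  using assms(3)
proof (induction J rule: infinite_finite_induct)
  case (insert i J)
  then have "L (v i + (\<Sum>i\<in>J. v i)) = L (v i) + L (\<Sum>i\<in>J. v i)"
    by (intro linear_at_add[OF assms(1)] tangent_space_sum[OF assms(2)]) auto
  then show ?case using insert by (simp only: sum.insert[OF insert.hyps] insertI2)
qed (simp_all only: sum.infinite sum.empty linear_at_zero[OF assms(1)] not_False_eq_True)

lemma riemannian_metric_linear_right: "riemannian_metric A g \<Longrightarrow> u \<in> tangent_space A p \<Longrightarrow> linear_at A p (g p u)"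
  unfolding riemannian_metric_def by blast

lemma riemannian_metric_commute:
  "riemannian_metric A g \<Longrightarrow> u \<in> tangent_space A p \<Longrightarrow> v \<in> tangent_space A p \<Longrightarrow> g p u v = g p v u"
  unfolding riemannian_metric_def by blast

lemma vector_fieldD: "vector_field A X \<Longrightarrow> X p \<in> tangent_space A p"
  unfolding vector_field_def by blast

text \<open>The Leibniz rule on 1 = 1 * 1 gives X(1) = 2 X(1), and homogeneity extends this to every
  constant.\<close>

lemma vector_field_const:
  assumes "smooth_atlas A" "vector_field A X"
  shows "X p (\<lambda>q. c) = 0"
proof -
  have v: "X p (\<lambda>q. a * h q) = a * X p h" if "smooth_fun A h" for a h
    using vector_fieldD[OF assms(2), of p] that unfolding tangent_space_def by simp
  have m: "X p (\<lambda>q. h q * k q) = h p * X p k + k p * X p h" if "smooth_fun A h" "smooth_fun A k" for h k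
    using vector_fieldD[OF assms(2), of p] that unfolding tangent_space_def by simp
  have "X p (\<lambda>q. 1) = 0"
    using m[OF smooth_fun_const smooth_fun_const, OF assms(1) assms(1), of 1 1] by simp
  then show ?thesis using v[OF smooth_fun_const[OF assms(1)], of c 1] by simp
qed

lemma framed_metric_f_manifoldD:
  assumes "framed_metric_f_manifold A n s f \<xi> \<eta> g"
  shows "smooth_atlas A" "1 \<le> s" "riemannian_metric A g" "tensor_11 A f"
    and "i \<in> {1..s} \<Longrightarrow> vector_field A (\<xi> i)"
    and "u \<in> tangent_space A p \<Longrightarrow> f p (f p u) = - u + (\<Sum>i=1..s. \<eta> i p u *\<^sub>R \<xi> i p)"
    and "i \<in> {1..s} \<Longrightarrow> j \<in> {1..s} \<Longrightarrow> \<eta> i p (\<xi> j p) = (if i = j then 1 else 0)"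
    and "i \<in> {1..s} \<Longrightarrow> f p (\<xi> i p) = 0"
    and "i \<in> {1..s} \<Longrightarrow> u \<in> tangent_space A p \<Longrightarrow> \<eta> i p (f p u) = 0"
    and "u \<in> tangent_space A p \<Longrightarrow> v \<in> tangent_space A p \<Longrightarrow>
        g p (f p u) (f p v) = g p u v - (\<Sum>i=1..s. \<eta> i p u * \<eta> i p v)"
    and "i \<in> {1..s} \<Longrightarrow> u \<in> tangent_space A p \<Longrightarrow> \<eta> i p u = g p u (\<xi> i p)"
  using assms unfolding framed_metric_f_manifold_def by simp_all

lemma trans_S_manifoldD:
  assumes "trans_S_manifold A n s f \<xi> \<eta> g nabla \<alpha> \<beta>"
  shows "framed_metric_f_manifold A n s f \<xi> \<eta> g" "normal_framed A s f \<xi> \<eta>" "levi_civita A g nabla"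
    and "vector_field A X \<Longrightarrow> vector_field A Y \<Longrightarrow>
        cov_deriv_tensor nabla f X Y p =
          (\<Sum>i=1..s.
             \<alpha> i p *\<^sub>R (g p (f p (X p)) (f p (Y p)) *\<^sub>R \<xi> i p + \<eta> i p (Y p) *\<^sub>R f p (f p (X p))) +
             \<beta> i p *\<^sub>R (g p (f p (X p)) (Y p) *\<^sub>R \<xi> i p - \<eta> i p (Y p) *\<^sub>R f p (X p)))"
proof -
  note M = assms[unfolded trans_S_manifold_def]
  show "framed_metric_f_manifold A n s f \<xi> \<eta> g" "normal_framed A s f \<xi> \<eta>" "levi_civita A g nabla"
    using M by simp_all
qed (rule assms[unfolded trans_S_manifold_def, THEN conjunct2, THEN conjunct2, THEN conjunct2, THEN conjunct2,
      rule_format])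

lemma tensor_11D:
  assumes "tensor_11 A f"
  shows "linear_at A p (f p)" "u \<in> tangent_space A p \<Longrightarrow> f p u \<in> tangent_space A p"
    and "vector_field A X \<Longrightarrow> vector_field A (\<lambda>p. f p (X p))"
  using assms by (simp_all add: tensor_11_def image_subset_iff)

lemma levi_civitaD:
  assumes "levi_civita A g nabla"
  shows "vector_field A X \<Longrightarrow> vector_field A Y \<Longrightarrow> vector_field A (nabla X Y)"
    and "vector_field A X \<Longrightarrow> vector_field A Y \<Longrightarrow> vector_field A Z \<Longrightarrow> nabla X (Y + Z) = nabla X Y + nabla X Z"
    and "vector_field A X \<Longrightarrow> vector_field A Y \<Longrightarrow> lie_bracket X Y = nabla X Y - nabla Y X"
    and "vector_field A X \<Longrightarrow> vector_field A Y \<Longrightarrow> vector_field A Z \<Longrightarrow>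
      X p (\<lambda>q. g q (Y q) (Z q)) = g p (nabla X Y p) (Z p) + g p (Y p) (nabla X Z p)"
proof -
  note L = assms[unfolded levi_civita_def affine_connection_def]
  show "vector_field A X \<Longrightarrow> vector_field A Y \<Longrightarrow> vector_field A (nabla X Y)"
    by (rule L[THEN conjunct1, THEN conjunct1, rule_format])
  show "vector_field A X \<Longrightarrow> vector_field A Y \<Longrightarrow> vector_field A Z \<Longrightarrow> nabla X (Y + Z) = nabla X Y + nabla X Z"
    by (rule L[THEN conjunct1, THEN conjunct2, THEN conjunct2, THEN conjunct2, THEN conjunct1, rule_format])
  show "vector_field A X \<Longrightarrow> vector_field A Y \<Longrightarrow> lie_bracket X Y = nabla X Y - nabla Y X"
    by (rule L[THEN conjunct2, THEN conjunct1, rule_format, symmetric])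
  show "vector_field A X \<Longrightarrow> vector_field A Y \<Longrightarrow> vector_field A Z \<Longrightarrow>
      X p (\<lambda>q. g q (Y q) (Z q)) = g p (nabla X Y p) (Z p) + g p (Y p) (nabla X Z p)"
    by (rule L[THEN conjunct2, THEN conjunct2, rule_format])
qed

text \<open>Compatibility of \<open>g\<close> with \<open>f\<close>, applied to the pair fu, u,
  gives g(ffu, fu) = g(fu, u), since every \<eta>_i kills fu. Expanding ffu instead, with fu
  orthogonal to all \<xi>_i, gives the opposite sign.\<close>

lemma framed_metric_f_skew:
  assumes M: "framed_metric_f_manifold A n s f \<xi> \<eta> g"
    and "u \<in> tangent_space A p"
  shows "g p (f p u) u = 0"
proof -
  note D = framed_metric_f_manifoldD[OF M] and T = tensor_11D[OF D(4)] and gl = riemannian_metric_linear_right[OF D(3)]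
  have u: "f p u \<in> tangent_space A p" "f p (f p u) \<in> tangent_space A p" using T(2) assms(2) by auto
  have xi: "\<eta> i p u *\<^sub>R \<xi> i p \<in> tangent_space A p" if "i \<in> {1..s}" for i
    using tangent_space_scaleR[OF vector_fieldD[OF D(5)[OF that]]] .
  have "g p (f p (f p u)) (f p u) = g p (f p u) u"
    using D(10)[OF u(1) assms(2)] D(9) assms(2) by simp
  moreover have "g p (f p u) (f p (f p u)) = - g p (f p u) u"
  proof -
    have "g p (f p u) (\<Sum>i=1..s. \<eta> i p u *\<^sub>R \<xi> i p) = (\<Sum>i=1..s. g p (f p u) (\<eta> i p u *\<^sub>R \<xi> i p))"
      by (rule linear_at_sum[OF gl[OF u(1)] D(1) xi])
    also have "\<dots> = 0"
    proof (rule sum.neutral, rule ballI)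
      fix i assume i: "i \<in> {1..s}"
      show "g p (f p u) (\<eta> i p u *\<^sub>R \<xi> i p) = 0"
        using linear_at_scaleR[OF gl[OF u(1)] vector_fieldD[OF D(5)[OF i]]] D(11)[OF i u(1)] D(9)[OF i assms(2)]
        by simp
    qed
    finally show ?thesis
      unfolding D(6)[OF assms(2)]
      using linear_at_add[OF gl[OF u(1)] tangent_space_uminus[OF assms(2)] tangent_space_sum[OF D(1) xi],
          where J1 = "{1..s}" and i2 = "\<lambda>i. i"]
        linear_at_uminus[OF gl[OF u(1)] assms(2)] by simp
  qed
  moreover have "g p (f p (f p u)) (f p u) = g p (f p u) (f p (f p u))"
    using riemannian_metric_commute[OF D(3) u(2,1)] .
  ultimately show ?thesis by simp
qed

text \<open>Insert Y = \<xi>_j in the structure equation: the left side becomes -f(\<nabla>_X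
  \<xi>_j), both metric terms vanish, and \<eta>_i(\<xi>_j) keeps only the summand i = j. This
  determines \<nabla>_X \<xi>_j up to the kernel of \<open>f\<close>, which is spanned by the
  \<xi>_i.\<close>

lemma trans_S_f_nabla_xi:
  assumes M: "trans_S_manifold A n s f \<xi> \<eta> g nabla \<alpha> \<beta>"
    and j: "j \<in> {1..s}" and X: "vector_field A X"
  shows "f p (nabla X (\<xi> j) p) = \<beta> j p *\<^sub>R f p (X p) - \<alpha> j p *\<^sub>R f p (f p (X p))"
proof -
  note D = framed_metric_f_manifoldD[OF trans_S_manifoldD(1)[OF M]] and T = tensor_11D[OF D(4)]
    and L = levi_civitaD[OF trans_S_manifoldD(3)[OF M]] and gl = riemannian_metric_linear_right[OF D(3)]
  note x = vector_fieldD[OF X, of p] and xi = D(5)[OF j]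
  have zero: "(\<lambda>q. f q (\<xi> j q)) = 0" using D(8)[OF j] by (simp add: fun_eq_iff)
  \<comment> \<open>The zero field is recognised as a vector field because it is the image of
    \<xi>_j under \<open>f\<close>; additivity of the connection then makes its derivative
    vanish.\<close>
  then have vf0: "vector_field A (0 :: 'a vfield)" using T(3)[OF xi] by metis
  have nabla0: "nabla X 0 = 0" using L(2)[OF X vf0 vf0] by simp
  have "g p (f p (X p)) 0 = 0" using linear_at_zero[OF gl[OF T(2)[OF x]]] .
  moreover have "g p (f p (X p)) (\<xi> j p) = 0"
    using D(9)[OF j x] D(11)[OF j T(2)[OF x]] by simp
  ultimately have tm: "\<alpha> i p *\<^sub>R (g p (f p (X p)) (f p (\<xi> j p)) *\<^sub>R \<xi> i p + \<eta> i p (\<xi> j p) *\<^sub>R f p (f p (X p))) +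
      \<beta> i p *\<^sub>R (g p (f p (X p)) (\<xi> j p) *\<^sub>R \<xi> i p - \<eta> i p (\<xi> j p) *\<^sub>R f p (X p))
    = (if j = i then \<alpha> j p *\<^sub>R f p (f p (X p)) - \<beta> j p *\<^sub>R f p (X p) else 0)" if "i \<in> {1..s}" for i
    using D(7)[OF that j] D(8)[OF j] by simp
  have "cov_deriv_tensor nabla f X (\<xi> j) p = \<alpha> j p *\<^sub>R f p (f p (X p)) - \<beta> j p *\<^sub>R f p (X p)"
    unfolding trans_S_manifoldD(4)[OF M X xi] using j
    by (subst sum.cong[OF refl tm]) (assumption, subst sum.delta', simp_all only: finite_atLeastAtMost if_True)
  moreover have "cov_deriv_tensor nabla f X (\<xi> j) p = - f p (nabla X (\<xi> j) p)"
    unfolding cov_deriv_tensor_def zero nabla0 by simp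
  ultimately have "- f p (nabla X (\<xi> j) p) = \<alpha> j p *\<^sub>R f p (f p (X p)) - \<beta> j p *\<^sub>R f p (X p)" by simp
  from arg_cong[OF this, of uminus] show ?thesis by (simp only: minus_minus minus_diff_eq)
qed

text \<open>This is the \<open>\<xi>\<^sub>k\<close>-component of the normality condition for the pair \<open>X, \<xi>\<^sub>j\<close>,
  namely \<open>d\<eta>\<^sub>k(X, \<xi>\<^sub>j) = 0\<close>.\<close>

lemma normal_nabla_xi:
  assumes M: "framed_metric_f_manifold A n s f \<xi> \<eta> g" and N: "normal_framed A s f \<xi> \<eta>"
    and LC: "levi_civita A g nabla"
    and j: "j \<in> {1..s}" and k: "k \<in> {1..s}" and X: "vector_field A X"
  shows "\<eta> k p (nabla X (\<xi> j) p) = - g p (X p) (nabla (\<xi> j) (\<xi> k) p)"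
proof -
  note D = framed_metric_f_manifoldD[OF M] and T = tensor_11D[OF D(4)]
    and L = levi_civitaD[OF LC] and gl = riemannian_metric_linear_right[OF D(3)]
  note x = vector_fieldD[OF X, of p] and xij = D(5)[OF j] and xik = D(5)[OF k]
  define B where "B = lie_bracket X (\<xi> j) p"
  define C where "C = lie_bracket (\<lambda>q. f q (X q)) (\<xi> j) p"
  define d where "d i = 2 * ext_deriv (\<eta> i) X (\<xi> j) p" for i
  define u where "u = nabla X (\<xi> j) p"
  define v where "v = nabla (\<xi> j) X p"
  define w where "w = nabla (\<xi> j) (\<xi> k) p"
  have T_uv: "u \<in> tangent_space A p" "v \<in> tangent_space A p" "w \<in> tangent_space A p"
    unfolding u_def v_def w_def by (intro vector_fieldD L(1) X xij xik)+
  have Beq: "B = u - v" unfolding B_def u_def v_def L(3)[OF X xij] by simp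
  have TB: "B \<in> tangent_space A p"
    unfolding Beq using tangent_space_add[OF D(1) T_uv(1) tangent_space_uminus[OF T_uv(2)]] by simp
  have TC: "C \<in> tangent_space A p"
    unfolding C_def L(3)[OF T(3)[OF X] xij]
    using tangent_space_add[OF D(1) vector_fieldD[OF L(1)[OF T(3)[OF X] xij]]
        tangent_space_uminus[OF vector_fieldD[OF L(1)[OF xij T(3)[OF X]]]], of p] by simp
  have zero: "(\<lambda>q. f q (\<xi> j q)) = (\<lambda>q h. 0)" using D(8)[OF j] by (simp add: fun_eq_iff)
  \<comment> \<open>Since f \<xi>_j = 0, the two Nijenhuis brackets containing f \<xi>_j drop out,
    leaving only those of X and of fX with \<xi>_j, both under \<open>f\<close>.\<close>
  have br0: "lie_bracket Y (\<lambda>q. f q (\<xi> j q)) p = 0" if "vector_field A Y" for Y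
    unfolding zero lie_bracket_def using vector_field_const[OF D(1) that] by (simp add: fun_eq_iff)
  have xi_T: "\<xi> i p \<in> tangent_space A p" if "i \<in> {1..s}" for i using vector_fieldD[OF D(5)[OF that]] .
  have f0: "f p 0 = 0" by (rule linear_at_zero[OF T(1)])
  have "f p (f p B) - f p C + 2 *\<^sub>R (\<Sum>i=1..s. ext_deriv (\<eta> i) X (\<xi> j) p *\<^sub>R \<xi> i p) = 0"
    using N[unfolded normal_framed_def, rule_format, OF X xij, of p]
    unfolding nijenhuis_def br0[OF X] br0[OF T(3)[OF X]] B_def C_def f0 by simp
  then have S: "(\<Sum>i=1..s. d i *\<^sub>R \<xi> i p) = f p C - f p (f p B)"
    unfolding d_def by (simp add: scaleR_right.sum eq_neg_iff_add_eq_0 algebra_simps)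
  \<comment> \<open>Pairing with \<xi>_k extracts \<open>d k\<close> by orthonormality, while the
    other side lies in the image of \<open>f\<close> and is therefore orthogonal to \<xi>_k.\<close>
  have "g p (\<xi> k p) (\<Sum>i=1..s. d i *\<^sub>R \<xi> i p) = (\<Sum>i=1..s. d i * g p (\<xi> k p) (\<xi> i p))"
    using linear_at_sum[OF gl[OF xi_T[OF k]] D(1), of "{1..s}" "\<lambda>i. d i *\<^sub>R \<xi> i p"]
      linear_at_scaleR[OF gl[OF xi_T[OF k]] xi_T] tangent_space_scaleR[OF xi_T] by simp
  also have "\<dots> = (\<Sum>i=1..s. if k = i then d i else 0)"
  proof (intro sum.cong refl)
    fix i assume i: "i \<in> {1..s}"
    show "d i * g p (\<xi> k p) (\<xi> i p) = (if k = i then d i else 0)"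
      using D(7)[OF i k, of p] unfolding D(11)[OF i xi_T[OF k]] by simp
  qed
  also have "\<dots> = d k" using k by simp
  finally have "d k = g p (\<xi> k p) (f p C - f p (f p B))" unfolding S by simp
  also have "\<dots> = g p (\<xi> k p) (f p C) - g p (\<xi> k p) (f p (f p B))"
    using linear_at_diff[OF gl[OF xi_T[OF k]] T(2) T(2)] T(2) TB TC by blast
  also have "\<dots> = 0"
    using riemannian_metric_commute[OF D(3) xi_T[OF k]] D(9)[OF k] D(11)[OF k] T(2) TB TC by simp
  \<comment> \<open>This is d\<eta>_k(X, \<xi>_j) = 0 written out. The first term differentiates a
    constant, metric compatibility expands the second and vanishing torsion the third; the
    contributions of \<open>v\<close> cancel.\<close>
  finally have "X p (\<lambda>q. \<eta> k q (\<xi> j q)) - \<xi> j p (\<lambda>q. \<eta> k q (X q)) - \<eta> k p B = 0"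
    unfolding d_def ext_deriv_def B_def by simp
  moreover have "X p (\<lambda>q. \<eta> k q (\<xi> j q)) = 0"
    unfolding D(7)[OF k j] by (rule vector_field_const[OF D(1) X])
  moreover have "\<xi> j p (\<lambda>q. \<eta> k q (X q)) = g p v (\<xi> k p) + g p (X p) w"
    unfolding D(11)[OF k vector_fieldD[OF X]] v_def w_def by (rule L(4)[OF xij X xik])
  moreover have "\<eta> k p B = \<eta> k p u - g p v (\<xi> k p)"
  proof -
    have "g p (\<xi> k p) B = g p (\<xi> k p) u - g p (\<xi> k p) v"
      unfolding Beq by (rule linear_at_diff[OF gl[OF xi_T[OF k]] T_uv(1,2)])
    then show ?thesis
      using riemannian_metric_commute[OF D(3) xi_T[OF k]] D(11)[OF k] TB T_uv by simp
  qed
  ultimately show ?thesis unfolding u_def w_def by simp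
qed

text \<open>Each \<nabla>_{\<xi>_j} \<xi>_k lies in the kernel of \<open>f\<close>, hence is a
  combination of the \<xi>_i and orthogonal to a vector on which all \<eta>_i vanish. By
  \<open>normal_nabla_xi\<close> the derivative \<nabla>_X \<xi>_j then has no \<xi>-components. On
  such vectors ff = -id, so applying \<open>f\<close> to the formula of
  \<open>trans_S_f_nabla_xi\<close> inverts it. The Legendre condition is imposed at
  \<open>p\<close> alone, which is what an extension of the velocity at one parameter
  satisfies.\<close>

lemma trans_S_nabla_xi:
  assumes M: "trans_S_manifold A n s f \<xi> \<eta> g nabla \<alpha> \<beta>"
    and j: "j \<in> {1..s}" and X: "vector_field A X"
    and legendre: "\<And>i. i \<in> {1..s} \<Longrightarrow> \<eta> i p (X p) = 0"
  shows "nabla X (\<xi> j) p = \<beta> j p *\<^sub>R X p - \<alpha> j p *\<^sub>R f p (X p)"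
proof -
  note D = framed_metric_f_manifoldD[OF trans_S_manifoldD(1)[OF M]] and T = tensor_11D[OF D(4)]
    and L = levi_civitaD[OF trans_S_manifoldD(3)[OF M]] and gl = riemannian_metric_linear_right[OF D(3)]
  note x = vector_fieldD[OF X, of p] and xij = D(5)[OF j]
  have xi_T: "\<xi> i p \<in> tangent_space A p" if "i \<in> {1..s}" for i using vector_fieldD[OF D(5)[OF that]] .
  define N where "N = nabla X (\<xi> j) p"
  have TN: "N \<in> tangent_space A p" unfolding N_def by (intro vector_fieldD L(1) X xij)
  have eta0: "\<eta> k p N = 0" if k: "k \<in> {1..s}" for k
  proof -
    define Z where "Z = nabla (\<xi> j) (\<xi> k) p"
    have TZ: "Z \<in> tangent_space A p" unfolding Z_def by (intro vector_fieldD L(1) D(5) j k)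
    have "f p Z = 0"
      unfolding Z_def trans_S_f_nabla_xi[OF M k xij] D(8)[OF j] linear_at_zero[OF T(1)] by simp
    then have "- Z + (\<Sum>i=1..s. \<eta> i p Z *\<^sub>R \<xi> i p) = 0"
      using D(6)[OF TZ] linear_at_zero[OF T(1), of p] by (simp only:)
    then have "(\<Sum>i=1..s. \<eta> i p Z *\<^sub>R \<xi> i p) = Z" by (simp only: add_eq_0_iff minus_minus)
    then have "g p (X p) Z = g p (X p) (\<Sum>i=1..s. \<eta> i p Z *\<^sub>R \<xi> i p)" by simp
    also have "\<dots> = (\<Sum>i=1..s. g p (X p) (\<eta> i p Z *\<^sub>R \<xi> i p))"
      by (rule linear_at_sum[OF gl[OF x] D(1) tangent_space_scaleR[OF xi_T]])
    also have "\<dots> = 0"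
      using linear_at_scaleR[OF gl[OF x] xi_T] D(11)[OF _ x] legendre by (intro sum.neutral) simp
    finally show ?thesis
      using normal_nabla_xi[OF trans_S_manifoldD(1-3)[OF M] j k X, of p] unfolding N_def Z_def by simp
  qed
  have ff: "f p (f p u) = - u" if "u \<in> tangent_space A p" "\<And>i. i \<in> {1..s} \<Longrightarrow> \<eta> i p u = 0" for u
    using D(6)[OF that(1)] that(2) by simp
  have ffX: "f p (f p (X p)) = - X p" by (rule ff[OF x]) (rule legendre)
  have ffN: "f p (f p N) = - N" by (rule ff[OF TN]) (rule eta0)
  have "f p N = \<beta> j p *\<^sub>R f p (X p) + \<alpha> j p *\<^sub>R X p"
    unfolding N_def trans_S_f_nabla_xi[OF M j X] ffX by simp
  then have "f p (f p N) = f p (\<beta> j p *\<^sub>R f p (X p) + \<alpha> j p *\<^sub>R X p)" by simp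
  also have "\<dots> = \<beta> j p *\<^sub>R f p (f p (X p)) + \<alpha> j p *\<^sub>R f p (X p)"
    using linear_at_add[OF T(1) tangent_space_scaleR[OF T(2)[OF x]] tangent_space_scaleR[OF x]]
      linear_at_scaleR[OF T(1) T(2)[OF x]] linear_at_scaleR[OF T(1) x] by simp
  finally have "- N = \<alpha> j p *\<^sub>R f p (X p) - \<beta> j p *\<^sub>R X p"
    unfolding ffN ffX by simp
  from arg_cong[OF this, of uminus] show ?thesis unfolding N_def by (simp only: minus_minus minus_diff_eq)
qed

section \<open>Legendre Frenet curves\<close>

text \<open>Since c has no zero, |a| < 1, so w = arccos a stays strictly between 0 and \<pi>.
  Likewise |b| < sin w, so arccos(b / sin w) stays away from the endpoints where
  \<open>arccos\<close> is not smooth. The constant sign of c decides which half of the circle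
  \<phi> lies in.\<close>

lemma smooth_spherical_coordinates:
  fixes a b c :: "real \<Rightarrow> real"
  assumes S: "open S" and sm: "smooth_on S a" "smooth_on S b"
    and unit: "\<And>t. t \<in> S \<Longrightarrow> (a t)\<^sup>2 + (b t)\<^sup>2 + (c t)\<^sup>2 = 1"
    and sgn: "\<epsilon> = 1 \<or> \<epsilon> = -1" "\<And>t. t \<in> S \<Longrightarrow> \<epsilon> * c t > 0"
  obtains w \<phi> where "smooth_on S w" "smooth_on S \<phi>"
    and "\<And>t. t \<in> S \<Longrightarrow> cos (w t) = a t \<and> sin (w t) * cos (\<phi> t) = b t \<and> sin (w t) * sin (\<phi> t) = c t"
proof
  \<comment> \<open>\<open>q\<close> is sin w.\<close>
  define q where "q t = sqrt (1 + - (a t * a t))" for t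
  have c2: "(c t)\<^sup>2 > 0" if "t \<in> S" for t using sgn(2)[OF that] by auto
  have pos: "1 + - (a t * a t) > 0" if "t \<in> S" for t
    using unit[OF that] c2[OF that] zero_le_power2[of "b t"] unfolding power2_eq_square by linarith
  have q: "q t > 0" "(q t)\<^sup>2 = (b t)\<^sup>2 + (c t)\<^sup>2" if "t \<in> S" for t
    using pos[OF that] unit[OF that] by (auto simp: q_def power2_eq_square)
  have a1: "\<bar>a t\<bar> < 1" if "t \<in> S" for t
    using pos[OF that] abs_square_less_1[of "a t"] by (simp add: power2_eq_square)
  have b1: "\<bar>b t / q t\<bar> < 1" if "t \<in> S" for t
  proof -
    have "(b t / q t)\<^sup>2 < 1" using q[OF that] c2[OF that]
      by (simp add: power_divide divide_less_eq_1 sum_power2_gt_zero_iff)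
    then show ?thesis by (rule abs_square_less_1[THEN iffD1])
  qed
  show "smooth_on S (\<lambda>t. arccos (a t))" using S sm(1) a1 by (rule smooth_on_arccos)
  have "smooth_on S q" unfolding q_def
    by (intro smooth_on_sqrt smooth_on_add smooth_on_const smooth_on_uminus smooth_on_mult S sm pos)
  then have "smooth_on S (\<lambda>t. b t / q t)" using q by (intro smooth_on_divide S sm) force+
  then show "smooth_on S (\<lambda>t. \<epsilon> * arccos (b t / q t))"
    using b1 by (intro smooth_on_mult smooth_on_const smooth_on_arccos S)
  show "cos (arccos (a t)) = a t \<and> sin (arccos (a t)) * cos (\<epsilon> * arccos (b t / q t)) = b t
      \<and> sin (arccos (a t)) * sin (\<epsilon> * arccos (b t / q t)) = c t" if t: "t \<in> S" for t
  proof (intro conjI)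
    show "cos (arccos (a t)) = a t" using a1[OF t] by (intro cos_arccos_abs) simp
    have sw: "sin (arccos (a t)) = q t"
      using a1[OF t] by (simp add: sin_arccos_abs q_def power2_eq_square)
    have "cos (\<epsilon> * arccos (b t / q t)) = b t / q t"
      using sgn(1) cos_arccos_abs[OF less_imp_le[OF b1[OF t]]] by auto
    then show "sin (arccos (a t)) * cos (\<epsilon> * arccos (b t / q t)) = b t"
      using q[OF t] sw by simp
    have "sin (\<epsilon> * arccos (b t / q t)) = \<epsilon> * sqrt (1 - (b t / q t)\<^sup>2)"
      using sgn(1) sin_arccos_abs[OF less_imp_le[OF b1[OF t]]] by auto
    also have "1 - (b t / q t)\<^sup>2 = ((q t)\<^sup>2 - (b t)\<^sup>2) / (q t)\<^sup>2"
      using q(1)[OF t] by (simp add: power_divide diff_divide_distrib)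
    also have "\<dots> = (c t / q t)\<^sup>2" unfolding q(2)[OF t] power_divide by simp
    also have "\<epsilon> * sqrt ((c t / q t)\<^sup>2) = c t / q t"
      using sgn(1) sgn(2)[OF t] q(1)[OF t] by auto
    finally show "sin (arccos (a t)) * sin (\<epsilon> * arccos (b t / q t)) = c t"
      using q[OF t] sw by simp
  qed
qed

lemma continuous_nonzero_constant_sign:
  fixes u :: "real \<Rightarrow> real"
  assumes "is_interval S" "continuous_on S u" "\<And>t. t \<in> S \<Longrightarrow> u t \<noteq> 0"
  obtains \<epsilon> :: real where "\<epsilon> = 1 \<or> \<epsilon> = -1" "\<And>t. t \<in> S \<Longrightarrow> \<epsilon> * u t > 0"
proof -
  have "connected (u ` S)"
    using assms(1,2) by (intro connected_continuous_image) (auto simp: is_interval_connected_1)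
  then have "\<not> (\<exists>x\<in>S. \<exists>y\<in>S. u x < 0 \<and> 0 < u y)"
    using connectedD_interval[of "u ` S" _ _ 0] assms(3) by fastforce
  then have "(\<forall>t\<in>S. u t > 0) \<or> (\<forall>t\<in>S. u t < 0)" using assms(3) by (meson linorder_neqE)
  then show thesis
  proof
    assume "\<forall>t\<in>S. u t > 0" then show thesis using that[of 1] by simp
  next
    assume "\<forall>t\<in>S. u t < 0" then show thesis using that[of "-1"] by simp
  qed
qed

lemma deriv_locally_constant:
  fixes u :: "real \<Rightarrow> real"
  assumes "open S" "t \<in> S" "\<And>t. t \<in> S \<Longrightarrow> u t = c"
  shows "deriv u t = 0"
  by (rule DERIV_imp_deriv, rule has_field_derivative_transform_within_open[OF DERIV_const assms(1,2)])
     (simp add: assms(3))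

section \<open>Calculus in the Frenet frame\<close>

locale legendre_frenet_curve =
  fixes A :: "('m::{t2_space, second_countable_topology}, 'e::euclidean_space) chart set"
    and n s r :: nat
    and f :: "'m \<Rightarrow> 'm tvec \<Rightarrow> 'm tvec"
    and \<xi> :: "nat \<Rightarrow> 'm vfield"
    and \<eta> :: "nat \<Rightarrow> 'm \<Rightarrow> 'm tvec \<Rightarrow> real"
    and g :: "'m \<Rightarrow> 'm tvec \<Rightarrow> 'm tvec \<Rightarrow> real"
    and nabla :: "'m vfield \<Rightarrow> 'm vfield \<Rightarrow> 'm vfield"
    and \<alpha> \<beta> :: "nat \<Rightarrow> 'm \<Rightarrow> real"
    and I :: "real set"
    and \<gamma> :: "real \<Rightarrow> 'm"
    and D :: "(real \<Rightarrow> 'm tvec) \<Rightarrow> real \<Rightarrow> 'm tvec"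
    and E :: "nat \<Rightarrow> real \<Rightarrow> 'm tvec"
    and \<kappa> :: "nat \<Rightarrow> real \<Rightarrow> real"
  assumes trans_S: "trans_S_manifold A n s f \<xi> \<eta> g nabla \<alpha> \<beta>"
    and open_I: "open I" and interval_I: "is_interval I"
    and cov: "cov_deriv_along A nabla I \<gamma> D"
    and frenet: "frenet_curve A g I \<gamma> D r E \<kappa>" and r_ge_4: "4 \<le> r"
    and legendre: "legendre_curve A s \<eta> I \<gamma>"
    and r_eq_4: "r = 4 \<Longrightarrow> \<forall>t\<in>I. \<kappa> 4 t = 0 \<and> E 5 t = 0"
begin

lemmas framed = framed_metric_f_manifoldD[OF trans_S_manifoldD(1)[OF trans_S]]
lemmas atlas = framed(1)
lemmas metric = framed(3)
lemmas metric_linear = riemannian_metric_linear_right[OF metric]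

abbreviation "Xi t \<equiv> \<Sum>i=1..s. \<xi> i (\<gamma> t)"

text \<open>Five coefficients suffice for the whole argument: the fields that get differentiated lie
  in the span of E_1 to E_4, and one derivative of such a field reaches no further than E_5.\<close>

definition comb :: "real \<Rightarrow> real \<Rightarrow> real \<Rightarrow> real \<Rightarrow> real \<Rightarrow> real \<Rightarrow> 'm tvec" where
  "comb t a b c d e = a *\<^sub>R E 1 t + b *\<^sub>R E 2 t + c *\<^sub>R E 3 t + d *\<^sub>R E 4 t + e *\<^sub>R E 5 t"

lemma curve: "smooth_curve A I \<gamma>"
  using frenet unfolding frenet_curve_def by simp

lemma E_field: "j \<in> {1..r} \<Longrightarrow> field_along A I \<gamma> (E j)"
  using frenet unfolding frenet_curve_def by simp

lemma E_velocity: "t \<in> I \<Longrightarrow> E 1 t = velocity A \<gamma> t"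
  using frenet unfolding frenet_curve_def by simp

lemma E_orthonormal:
  "i \<in> {1..r} \<Longrightarrow> j \<in> {1..r} \<Longrightarrow> t \<in> I \<Longrightarrow> g (\<gamma> t) (E i t) (E j t) = (if i = j then 1 else 0)"
  using frenet unfolding frenet_curve_def by simp

lemma curvature: "j \<in> {1..<r} \<Longrightarrow> smooth_on I (\<kappa> j)" "j \<in> {1..<r} \<Longrightarrow> t \<in> I \<Longrightarrow> \<kappa> j t > 0"
  using frenet unfolding frenet_curve_def by simp_all

lemma frenet_equation:
  "j \<in> {1..r} \<Longrightarrow> t \<in> I \<Longrightarrow> D (E j) t =
    (if j = 1 then 0 else - (\<kappa> (j - 1) t *\<^sub>R E (j - 1) t)) + (if j = r then 0 else \<kappa> j t *\<^sub>R E (j + 1) t)"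
  using frenet unfolding frenet_curve_def by (elim conjE) (drule (1) bspec, drule (1) bspec, assumption)

lemma curvature_smooth: "smooth_on I (\<kappa> 1)" "smooth_on I (\<kappa> 2)" "smooth_on I (\<kappa> 3)"
  using r_ge_4 by (auto intro!: curvature(1))

lemma curvature_pos: "t \<in> I \<Longrightarrow> \<kappa> 1 t > 0" "t \<in> I \<Longrightarrow> \<kappa> 2 t > 0" "t \<in> I \<Longrightarrow> \<kappa> 3 t > 0"
  using r_ge_4 by (auto intro!: curvature(2))

lemma frenet_equations:
  assumes t: "t \<in> I"
  shows "D (E 1) t = \<kappa> 1 t *\<^sub>R E 2 t"
    and "D (E 2) t = - (\<kappa> 1 t *\<^sub>R E 1 t) + \<kappa> 2 t *\<^sub>R E 3 t"
    and "D (E 3) t = - (\<kappa> 2 t *\<^sub>R E 2 t) + \<kappa> 3 t *\<^sub>R E 4 t"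
    and "D (E 4) t = - (\<kappa> 3 t *\<^sub>R E 3 t) + \<kappa> 4 t *\<^sub>R E 5 t"
proof -
  have *: "(1::nat) + 1 = 2" "(2::nat) + 1 = 3" "(3::nat) + 1 = 4" "(4::nat) + 1 = 5"
    "(2::nat) - 1 = 1" "(3::nat) - 1 = 2" "(4::nat) - 1 = 3" by simp_all
  show "D (E 1) t = \<kappa> 1 t *\<^sub>R E 2 t"
    using frenet_equation[of 1, OF _ t] r_ge_4 unfolding * by simp
  show "D (E 2) t = - (\<kappa> 1 t *\<^sub>R E 1 t) + \<kappa> 2 t *\<^sub>R E 3 t"
    using frenet_equation[of 2, OF _ t] r_ge_4 unfolding * by simp
  show "D (E 3) t = - (\<kappa> 2 t *\<^sub>R E 2 t) + \<kappa> 3 t *\<^sub>R E 4 t"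
    using frenet_equation[of 3, OF _ t] r_ge_4 unfolding * by simp
  \<comment> \<open>For \<open>r = 4\<close> the Frenet equation ends after the first term, and the
    convention on \<open>\<kappa> 4\<close> and \<open>E 5\<close> makes the second term
    zero.\<close>
  show "D (E 4) t = - (\<kappa> 3 t *\<^sub>R E 3 t) + \<kappa> 4 t *\<^sub>R E 5 t"
    using frenet_equation[of 4, OF _ t] r_ge_4 r_eq_4 t unfolding * by (cases "r = 4") simp_all
qed

lemma E_tangent: "j \<in> {1..5} \<Longrightarrow> t \<in> I \<Longrightarrow> E j t \<in> tangent_space A (\<gamma> t)"
proof (cases "j \<le> r")
  case True
  then show "j \<in> {1..5} \<Longrightarrow> t \<in> I \<Longrightarrow> ?thesis" using field_alongD[OF E_field] by simp
next
  case False
  assume "j \<in> {1..5}" "t \<in> I"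
  with False r_ge_4 have "r = 4" "j = 5" by auto
  then show ?thesis using r_eq_4 \<open>t \<in> I\<close> tangent_space_zero by simp
qed

lemma E_orthogonal_E5:
  assumes "t \<in> I" "j \<in> {1..4}"
  shows "g (\<gamma> t) (E j t) (E 5 t) = 0"
proof (cases "r = 4")
  case True
  then show ?thesis
    using r_eq_4 assms linear_at_zero[OF metric_linear[OF E_tangent[of j t]]] by simp
next
  case False
  then show ?thesis using E_orthonormal[of j 5 t] assms r_ge_4 by simp
qed

lemma comb_tangent:
  assumes "t \<in> I"
  shows "comb t a b c d e \<in> tangent_space A (\<gamma> t)"
  unfolding comb_def
  by (intro tangent_space_add[OF atlas] tangent_space_scaleR E_tangent assms) simp_all

lemma metric_comb:
  assumes t: "t \<in> I" and u: "u \<in> tangent_space A (\<gamma> t)"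
  shows "g (\<gamma> t) u (comb t a b c d e) = a * g (\<gamma> t) u (E 1 t) + b * g (\<gamma> t) u (E 2 t)
    + c * g (\<gamma> t) u (E 3 t) + d * g (\<gamma> t) u (E 4 t) + e * g (\<gamma> t) u (E 5 t)"
proof -
  have E: "E j t \<in> tangent_space A (\<gamma> t)" if "j \<in> {1..5}" for j using E_tangent[OF that t] .
  show ?thesis
    unfolding comb_def
    by (simp add: linear_at_add[OF metric_linear[OF u]] linear_at_scaleR[OF metric_linear[OF u]]
        tangent_space_add[OF atlas] tangent_space_scaleR E)
qed

text \<open>The last identity keeps the factor \<open>g (\<gamma> t) (E 5 t) (E 5 t)\<close> because
  it is 1 for r > 4 but 0 for r = 4.\<close>

lemma metric_E_comb:
  assumes t: "t \<in> I"
  shows "g (\<gamma> t) (E 1 t) (comb t a b c d e) = a" "g (\<gamma> t) (E 2 t) (comb t a b c d e) = b"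
    "g (\<gamma> t) (E 3 t) (comb t a b c d e) = c" "g (\<gamma> t) (E 4 t) (comb t a b c d e) = d"
    "g (\<gamma> t) (E 5 t) (comb t a b c d e) = e * g (\<gamma> t) (E 5 t) (E 5 t)"
proof -
  have "g (\<gamma> t) (E i t) (E j t) = (if i = j then 1 else 0)" if "i \<in> {1..4}" "j \<in> {1..4}" for i j
    using that r_ge_4 by (intro E_orthonormal[OF _ _ t]) auto
  moreover have "g (\<gamma> t) (E i t) (E 5 t) = 0" "g (\<gamma> t) (E 5 t) (E i t) = 0" if "i \<in> {1..4}" for i
    using E_orthogonal_E5[OF t that] riemannian_metric_commute[OF metric E_tangent[of i, OF _ t] E_tangent[of 5, OF _ t]] that
    by simp_all
  ultimately show "g (\<gamma> t) (E 1 t) (comb t a b c d e) = a" "g (\<gamma> t) (E 2 t) (comb t a b c d e) = b"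
    "g (\<gamma> t) (E 3 t) (comb t a b c d e) = c" "g (\<gamma> t) (E 4 t) (comb t a b c d e) = d"
    "g (\<gamma> t) (E 5 t) (comb t a b c d e) = e * g (\<gamma> t) (E 5 t) (E 5 t)"
    by (simp_all add: metric_comb[OF t E_tangent[OF _ t]])
qed

lemma comb_field:
  assumes "smooth_on I a" "smooth_on I b" "smooth_on I c" "smooth_on I d"
  shows "field_along A I \<gamma> (\<lambda>t. comb t (a t) (b t) (c t) (d t) 0)"
proof -
  have "field_along A I \<gamma> (\<lambda>t. a t *\<^sub>R E 1 t + b t *\<^sub>R E 2 t + c t *\<^sub>R E 3 t + d t *\<^sub>R E 4 t)"
    using r_ge_4 by (intro field_along_add[OF atlas open_I] field_along_scaleR[OF open_I] assms E_field) auto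
  then show ?thesis unfolding comb_def scaleR_zero_left add_0_right .
qed

lemma D_comb:
  assumes sm: "smooth_on I a" "smooth_on I b" "smooth_on I c" "smooth_on I d" and t: "t \<in> I"
  shows "D (\<lambda>t. comb t (a t) (b t) (c t) (d t) 0) t =
    comb t (deriv a t - \<kappa> 1 t * b t) (deriv b t + \<kappa> 1 t * a t - \<kappa> 2 t * c t)
      (deriv c t + \<kappa> 2 t * b t - \<kappa> 3 t * d t) (deriv d t + \<kappa> 3 t * c t) (\<kappa> 4 t * d t)"
proof -
  have E: "field_along A I \<gamma> (E 1)" "field_along A I \<gamma> (E 2)" "field_along A I \<gamma> (E 3)" "field_along A I \<gamma> (E 4)"
    using r_ge_4 by (auto intro!: E_field)
  note fa = field_along_scaleR[OF open_I sm(1) E(1)] field_along_scaleR[OF open_I sm(2) E(2)]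
    field_along_scaleR[OF open_I sm(3) E(3)] field_along_scaleR[OF open_I sm(4) E(4)]
  note add = field_along_add[OF atlas open_I]
  have "D (\<lambda>t. a t *\<^sub>R E 1 t + b t *\<^sub>R E 2 t + c t *\<^sub>R E 3 t + d t *\<^sub>R E 4 t) t =
      (deriv a t *\<^sub>R E 1 t + a t *\<^sub>R D (E 1) t) + (deriv b t *\<^sub>R E 2 t + b t *\<^sub>R D (E 2) t)
      + (deriv c t *\<^sub>R E 3 t + c t *\<^sub>R D (E 3) t) + (deriv d t *\<^sub>R E 4 t + d t *\<^sub>R D (E 4) t)"
    by (simp only: cov_deriv_along_add[OF cov add[OF add[OF fa(1,2)] fa(3)] fa(4) t]
        cov_deriv_along_add[OF cov add[OF fa(1,2)] fa(3) t] cov_deriv_along_add[OF cov fa(1,2) t]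
        cov_deriv_along_scaleR[OF cov sm(1) E(1) t] cov_deriv_along_scaleR[OF cov sm(2) E(2) t]
        cov_deriv_along_scaleR[OF cov sm(3) E(3) t] cov_deriv_along_scaleR[OF cov sm(4) E(4) t])
  also have "\<dots> = comb t (deriv a t - \<kappa> 1 t * b t) (deriv b t + \<kappa> 1 t * a t - \<kappa> 2 t * c t)
      (deriv c t + \<kappa> 2 t * b t - \<kappa> 3 t * d t) (deriv d t + \<kappa> 3 t * c t) (\<kappa> 4 t * d t)"
    unfolding frenet_equations[OF t] comb_def by (simp add: algebra_simps)
  finally show ?thesis unfolding comb_def scaleR_zero_left add_0_right .
qed

lemma laplacian_mean_curvature:
  assumes t: "t \<in> I"
  shows "laplacian_along D (mean_curvature A \<gamma> D) t =
    - comb t (deriv (\<lambda>t. - (\<kappa> 1 t * \<kappa> 1 t)) t - \<kappa> 1 t * deriv (\<kappa> 1) t)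
      (deriv (deriv (\<kappa> 1)) t - \<kappa> 1 t * (\<kappa> 1 t * \<kappa> 1 t) - \<kappa> 2 t * (\<kappa> 1 t * \<kappa> 2 t))
      (deriv (\<lambda>t. \<kappa> 1 t * \<kappa> 2 t) t + \<kappa> 2 t * deriv (\<kappa> 1) t) (\<kappa> 3 t * (\<kappa> 1 t * \<kappa> 2 t)) 0"
proof -
  note sm = curvature_smooth smooth_on_deriv[OF curvature_smooth(1) open_I] smooth_on_const[OF open_I, of 0]
    smooth_on_mult[OF open_I curvature_smooth(1,2)]
    smooth_on_uminus[OF open_I smooth_on_mult[OF open_I curvature_smooth(1,1)]]
  have E1: "field_along A I \<gamma> (E 1)" using r_ge_4 by (auto intro!: E_field)
  have vel: "field_along A I \<gamma> (velocity A \<gamma>)" by (rule field_along_cong[OF open_I E1 E_velocity])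
  \<comment> \<open>\<open>H\<close> and \<open>K\<close> are the coefficient forms of the first and
    second derivatives of T. They agree with those derivatives on \<open>I\<close> only, so every
    further application of \<open>D\<close> passes through
    \<open>cov_deriv_along_cong\<close>.\<close>
  define H where "H = (\<lambda>t. comb t 0 (\<kappa> 1 t) 0 0 0)"
  define K where "K = (\<lambda>t. comb t (- (\<kappa> 1 t * \<kappa> 1 t)) (deriv (\<kappa> 1) t) (\<kappa> 1 t * \<kappa> 2 t) 0 0)"
  have H: "field_along A I \<gamma> H" unfolding H_def by (rule comb_field[OF sm(5,1,5,5)])
  have K: "field_along A I \<gamma> K" unfolding K_def by (rule comb_field[OF sm(7,4,6,5)])
  have DV: "D (velocity A \<gamma>) t = H t" if "t \<in> I" for t
  proof -
    have "D (velocity A \<gamma>) t = D (E 1) t"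
      by (rule cov_deriv_along_cong[OF cov vel E1 E_velocity[symmetric] that])
    then show ?thesis using frenet_equations(1)[OF that] by (simp add: H_def comb_def)
  qed
  then have fDV: "field_along A I \<gamma> (D (velocity A \<gamma>))"
    using field_along_cong[OF open_I H, of "D (velocity A \<gamma>)"] by simp
  have DDV: "D (D (velocity A \<gamma>)) t = K t" if "t \<in> I" for t
  proof -
    have "D (D (velocity A \<gamma>)) t = D H t" by (rule cov_deriv_along_cong[OF cov fDV H DV that])
    also have "\<dots> = K t"
      unfolding H_def K_def D_comb[OF sm(5,1,5,5) that] by (simp add: algebra_simps)
    finally show ?thesis .
  qed
  then have fDDV: "field_along A I \<gamma> (D (D (velocity A \<gamma>)))"
    using field_along_cong[OF open_I K, of "D (D (velocity A \<gamma>))"] by simp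
  have "D (D (D (velocity A \<gamma>))) t = D K t" by (rule cov_deriv_along_cong[OF cov fDDV K DDV t])
  also have "\<dots> = comb t (deriv (\<lambda>t. - (\<kappa> 1 t * \<kappa> 1 t)) t - \<kappa> 1 t * deriv (\<kappa> 1) t)
      (deriv (deriv (\<kappa> 1)) t - \<kappa> 1 t * (\<kappa> 1 t * \<kappa> 1 t) - \<kappa> 2 t * (\<kappa> 1 t * \<kappa> 2 t))
      (deriv (\<lambda>t. \<kappa> 1 t * \<kappa> 2 t) t + \<kappa> 2 t * deriv (\<kappa> 1) t) (\<kappa> 3 t * (\<kappa> 1 t * \<kappa> 2 t)) 0"
    unfolding K_def D_comb[OF sm(7,4,6,5) t] by simp
  finally show ?thesis unfolding laplacian_along_def mean_curvature_def by simp
qed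

text \<open>Because \<open>I\<close> is open, constancy of \<kappa>_1 on it kills the derivatives of
  \<kappa>_1 and of its square. The minus sign of the Laplacian is absorbed into the coefficients,
  which become the right sides of the three equations for \<lambda>.\<close>

lemma laplacian_constant_curvature:
  assumes const: "\<And>t. t \<in> I \<Longrightarrow> \<kappa> 1 t = k" and t: "t \<in> I"
  shows "laplacian_along D (mean_curvature A \<gamma> D) t =
    comb t 0 (\<kappa> 1 t * ((\<kappa> 1 t)\<^sup>2 + (\<kappa> 2 t)\<^sup>2)) (- (\<kappa> 1 t * deriv (\<kappa> 2) t)) (- (\<kappa> 1 t * \<kappa> 2 t * \<kappa> 3 t)) 0"
proof -
  have d1: "deriv (\<kappa> 1) t = 0" if "t \<in> I" for t
    by (rule deriv_locally_constant[OF open_I that const])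
  have d2: "deriv (deriv (\<kappa> 1)) t = 0"
    by (rule deriv_locally_constant[OF open_I t d1])
  have d3: "deriv (\<lambda>t. - (\<kappa> 1 t * \<kappa> 1 t)) t = 0"
    by (rule deriv_locally_constant[OF open_I t, of _ "- (k * k)"]) (simp only: const)
  have d4: "deriv (\<lambda>t. \<kappa> 1 t * \<kappa> 2 t) t = \<kappa> 1 t * deriv (\<kappa> 2) t"
    using DERIV_imp_deriv[OF DERIV_mult[OF smooth_on_has_real_derivative[OF curvature_smooth(1) open_I t]
      smooth_on_has_real_derivative[OF curvature_smooth(2) open_I t]]] d1[OF t] by (simp add: mult.commute)
  show ?thesis
    unfolding laplacian_mean_curvature[OF t] d1[OF t] d2 d3 d4 comb_def
    by (simp add: algebra_simps power2_eq_square)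
qed

section \<open>The sum of the structure vector fields along the curve\<close>

lemma xi_tangent: "i \<in> {1..s} \<Longrightarrow> \<xi> i (\<gamma> t) \<in> tangent_space A (\<gamma> t)"
  using vector_fieldD[OF framed(5)] .

lemma Xi_tangent: "Xi t \<in> tangent_space A (\<gamma> t)"
  by (intro tangent_space_sum[OF atlas] xi_tangent)

lemma metric_Xi: "u \<in> tangent_space A (\<gamma> t) \<Longrightarrow> g (\<gamma> t) u (Xi t) = (\<Sum>i=1..s. \<eta> i (\<gamma> t) u)"
  using framed(11) linear_at_sum[OF metric_linear atlas, of u "\<gamma> t" "{1..s}" "\<lambda>i. \<xi> i (\<gamma> t)"] xi_tangent
  by simp

lemma legendre_E1: "t \<in> I \<Longrightarrow> i \<in> {1..s} \<Longrightarrow> \<eta> i (\<gamma> t) (E 1 t) = 0"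
  using legendre E_velocity unfolding legendre_curve_def by simp

lemma metric_E1_Xi: "t \<in> I \<Longrightarrow> g (\<gamma> t) (E 1 t) (Xi t) = 0"
  using metric_Xi[OF E_tangent[of 1 t]] legendre_E1 by simp

lemma metric_Xi_Xi: "g (\<gamma> t) (Xi t) (Xi t) = real s"
proof -
  have "\<eta> i (\<gamma> t) (Xi t) = 1" if i: "i \<in> {1..s}" for i
  proof -
    have "\<eta> i (\<gamma> t) (Xi t) = g (\<gamma> t) (\<xi> i (\<gamma> t)) (Xi t)"
      using framed(11)[OF i Xi_tangent] riemannian_metric_commute[OF metric Xi_tangent xi_tangent[OF i]] by simp
    also have "\<dots> = (\<Sum>j=1..s. if j = i then 1 else 0)"
      unfolding metric_Xi[OF xi_tangent[OF i]] using framed(7)[OF _ i] by (intro sum.cong) simp_all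
    also have "\<dots> = 1" using i by simp
    finally show ?thesis .
  qed
  then have "(\<Sum>i=1..s. \<eta> i (\<gamma> t) (Xi t)) = (\<Sum>i=1..s. 1)" by (rule sum.cong[OF refl])
  then show ?thesis by (simp only: metric_Xi[OF Xi_tangent]) simp
qed

text \<open>The derivative along the curve is tied to \<open>nabla\<close> through vector fields on
  the manifold, so the velocity at \<open>t\<close> is first extended to such a field;
  \<open>trans_S_nabla_xi\<close> then applies to each \<xi>_i, and the results are summed.\<close>

lemma D_Xi:
  assumes t: "t \<in> I"
  shows "D Xi t = (\<Sum>i=1..s. \<beta> i (\<gamma> t)) *\<^sub>R E 1 t - (\<Sum>i=1..s. \<alpha> i (\<gamma> t)) *\<^sub>R f (\<gamma> t) (E 1 t)"
proof -
  obtain X where X: "vector_field A X" "X (\<gamma> t) = velocity A \<gamma> t"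
    using velocity_extends_to_vector_field[OF atlas curve open_I t] by blast
  have eta: "\<eta> i (\<gamma> t) (X (\<gamma> t)) = 0" if "i \<in> {1..s}" for i
    using legendre_E1[OF t that] X(2) E_velocity[OF t] by simp
  have "D Xi t = (\<Sum>i=1..s. D (\<lambda>t. \<xi> i (\<gamma> t)) t)"
    by (rule cov_deriv_along_sum[OF cov atlas open_I _ t])
       (rule vector_field_along_curve[OF atlas curve open_I framed(5)])
  also have "\<dots> = (\<Sum>i=1..s. \<beta> i (\<gamma> t) *\<^sub>R E 1 t - \<alpha> i (\<gamma> t) *\<^sub>R f (\<gamma> t) (E 1 t))"
  proof (rule sum.cong[OF refl])
    fix i assume i: "i \<in> {1..s}"
    have "D (\<lambda>t. \<xi> i (\<gamma> t)) t = nabla X (\<xi> i) (\<gamma> t)"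
      by (rule cov_deriv_along_vector_field[OF cov X(1) framed(5)[OF i] t X(2)])
    also have "\<dots> = \<beta> i (\<gamma> t) *\<^sub>R X (\<gamma> t) - \<alpha> i (\<gamma> t) *\<^sub>R f (\<gamma> t) (X (\<gamma> t))"
      by (rule trans_S_nabla_xi[OF trans_S i X(1)]) (rule eta)
    finally show "D (\<lambda>t. \<xi> i (\<gamma> t)) t = \<beta> i (\<gamma> t) *\<^sub>R E 1 t - \<alpha> i (\<gamma> t) *\<^sub>R f (\<gamma> t) (E 1 t)"
      unfolding X(2) E_velocity[OF t] .
  qed
  also have "\<dots> = (\<Sum>i=1..s. \<beta> i (\<gamma> t)) *\<^sub>R E 1 t - (\<Sum>i=1..s. \<alpha> i (\<gamma> t)) *\<^sub>R f (\<gamma> t) (E 1 t)"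
    by (simp only: sum_subtractf scaleR_left.sum)
  finally show ?thesis .
qed

text \<open>The two identities are the \<open>T\<close>- and the \<open>E\<^sub>5\<close>-component of the derivative of \<open>\<Sum>\<^sub>i \<xi>\<^sub>i\<close>.\<close>

lemma structure_functions_along:
  assumes sm: "smooth_on I a" "smooth_on I b" "smooth_on I c"
    and Xi: "\<And>t. t \<in> I \<Longrightarrow> Xi t = comb t 0 (a t) (b t) (c t) 0" and t: "t \<in> I"
  shows "(\<Sum>i=1..s. \<beta> i (\<gamma> t)) = - (\<kappa> 1 t * a t)"
    and "\<kappa> 4 t * c t = - ((\<Sum>i=1..s. \<alpha> i (\<gamma> t)) * g (\<gamma> t) (f (\<gamma> t) (E 1 t)) (E 5 t))"
proof -
  let ?T = "tangent_space A (\<gamma> t)" and ?g = "g (\<gamma> t)" and ?f = "f (\<gamma> t) (E 1 t)"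
  let ?a = "\<Sum>i=1..s. \<alpha> i (\<gamma> t)" and ?b = "\<Sum>i=1..s. \<beta> i (\<gamma> t)"
  have T: "E 1 t \<in> ?T" "E 5 t \<in> ?T" "?f \<in> ?T"
    using E_tangent[OF _ t] tensor_11D(2)[OF framed(4)] by simp_all
  note zero = smooth_on_const[OF open_I, of 0]
  have "field_along A I \<gamma> Xi"
    by (intro field_along_sum[OF atlas open_I] vector_field_along_curve[OF atlas curve open_I] framed(5))
  from cov_deriv_along_cong[OF cov this comb_field[OF zero sm] Xi t]
  have "?b *\<^sub>R E 1 t - ?a *\<^sub>R ?f = comb t (- (\<kappa> 1 t * a t)) (deriv a t - \<kappa> 2 t * b t)
      (deriv b t + \<kappa> 2 t * a t - \<kappa> 3 t * c t) (deriv c t + \<kappa> 3 t * b t) (\<kappa> 4 t * c t)" (is "_ = ?c")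
    unfolding D_Xi[OF t] D_comb[OF zero sm t] by simp
  \<comment> \<open>Both expressions for the derivative are paired with an arbitrary tangent vector,
    to be specialised to E_1 and E_5. For E_1 the \<alpha>-term disappears since fT is orthogonal to
    T.\<close>
  then have pair: "?b * ?g u (E 1 t) - ?a * ?g u ?f = ?g u ?c" if u: "u \<in> ?T" for u
    using linear_at_diff[OF metric_linear[OF u] tangent_space_scaleR[OF T(1)] tangent_space_scaleR[OF T(3)], of ?b ?a]
      linear_at_scaleR[OF metric_linear[OF u] T(1)] linear_at_scaleR[OF metric_linear[OF u] T(3)] by simp
  have "?g (E 1 t) ?f = 0" "?g (E 1 t) (E 1 t) = 1"
    using framed_metric_f_skew[OF trans_S_manifoldD(1)[OF trans_S] T(1)] riemannian_metric_commute[OF metric T(1,3)]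
      E_orthonormal[of 1 1, OF _ _ t] r_ge_4 by simp_all
  then show "?b = - (\<kappa> 1 t * a t)" using pair[OF T(1)] metric_E_comb(1)[OF t] by simp
  have "?g (E 5 t) (E 1 t) = 0" "?g (E 5 t) ?f = ?g ?f (E 5 t)"
    using E_orthogonal_E5[OF t, of 1] riemannian_metric_commute[OF metric T(2,1)]
      riemannian_metric_commute[OF metric T(2,3)] by simp_all
  then have *: "- (?a * ?g ?f (E 5 t)) = \<kappa> 4 t * c t * ?g (E 5 t) (E 5 t)"
    using pair[OF T(2)] metric_E_comb(5)[OF t] by simp
  show "\<kappa> 4 t * c t = - (?a * ?g ?f (E 5 t))"
  \<comment> \<open>For \<open>r = 4\<close> both \<open>\<kappa> 4 t\<close> and
    \<open>E 5 t\<close> are zero, so both sides vanish; for larger r the field E_5 has length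
    1.\<close>
  proof (cases "r = 4")
    case True
    then show ?thesis using r_eq_4 t * by simp
  next
    case False
    then have "?g (E 5 t) (E 5 t) = 1" using E_orthonormal[of 5 5, OF _ _ t] r_ge_4 by simp
    then show ?thesis using * by simp
  qed
qed

section \<open>The two implications\<close>

lemma C_proper_imp_constant_curvature:
  assumes "C_proper_tangent A s \<xi> I \<gamma> D lam"
  shows "\<exists>k. \<forall>t\<in>I. \<kappa> 1 t = k"
proof (rule has_field_derivative_zero_constant)
  show "convex I" using interval_I by (rule is_interval_convex)
  fix t assume t: "t \<in> I"
  note der = smooth_on_has_real_derivative[OF curvature_smooth(1) open_I t]
  have T: "E 1 t \<in> tangent_space A (\<gamma> t)" using E_tangent[of 1, OF _ t] by simp
  have "g (\<gamma> t) (E 1 t) (- (lam t *\<^sub>R Xi t)) = - (lam t *\<^sub>R g (\<gamma> t) (E 1 t) (Xi t))"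
    by (simp only: linear_at_uminus[OF metric_linear[OF T] tangent_space_scaleR[OF Xi_tangent]]
        linear_at_scaleR[OF metric_linear[OF T] Xi_tangent])
  also have "\<dots> = 0" using metric_E1_Xi[OF t] by simp
  finally have "g (\<gamma> t) (E 1 t) (- (lam t *\<^sub>R Xi t)) = 0" .
  moreover have "laplacian_along D (mean_curvature A \<gamma> D) t = lam t *\<^sub>R Xi t"
    by (rule assms[unfolded C_proper_tangent_def, THEN conjunct2, THEN conjunct2, rule_format, OF t])
  ultimately have "g (\<gamma> t) (E 1 t) (- laplacian_along D (mean_curvature A \<gamma> D) t) = 0" by (simp only:)
  \<comment> \<open>The left side is -3 \<kappa>_1 \<kappa>_1', the T-component of the negated
    Laplacian. It vanishes because \<open>Xi\<close> is orthogonal to T; positivity of \<kappa>_1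
    then leaves \<kappa>_1' = 0.\<close>
  then have "deriv (\<lambda>t. - (\<kappa> 1 t * \<kappa> 1 t)) t - \<kappa> 1 t * deriv (\<kappa> 1) t = 0"
    unfolding laplacian_mean_curvature[OF t] minus_minus metric_E_comb(1)[OF t] .
  moreover have "deriv (\<lambda>t. - (\<kappa> 1 t * \<kappa> 1 t)) t = - (2 * \<kappa> 1 t * deriv (\<kappa> 1) t)"
    using DERIV_imp_deriv[OF DERIV_minus[OF DERIV_mult[OF der der]]] by (simp only: mult.commute mult_2 distrib_left)
  ultimately have "\<kappa> 1 t * deriv (\<kappa> 1) t = 0" by linarith
  then have "deriv (\<kappa> 1) t = 0" using curvature_pos(1)[OF t] by (metis less_irrefl mult_eq_0_iff)
  with der have "(\<kappa> 1 has_real_derivative 0) (at t)" by (simp only:)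
  then show "(\<kappa> 1 has_real_derivative 0) (at t within I)" by (rule has_field_derivative_at_within)
qed

lemma E_combination:
  "sqrt (real s) *\<^sub>R (a *\<^sub>R E 2 t + b *\<^sub>R E 3 t + c *\<^sub>R E 4 t) =
    comb t 0 (sqrt (real s) * a) (sqrt (real s) * b) (sqrt (real s) * c) 0"
  unfolding comb_def by (simp add: scaleR_add_right)

text \<open>In the frame, \<lambda> \<open>Xi\<close> has the components P, Q, R of the Laplacian.
  Dividing them by the signed length L = \<lambda> sqrt s gives a unit vector field whose spherical
  coordinates are w and \<phi>.\<close>

lemma C_proper_imp_spherical:
  assumes C: "C_proper_tangent A s \<xi> I \<gamma> D lam" and const: "\<And>t. t \<in> I \<Longrightarrow> \<kappa> 1 t = k"
  obtains w \<phi> where "smooth_on I w" "smooth_on I \<phi>"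
    and "\<And>t. t \<in> I \<Longrightarrow> Xi t = comb t 0 (sqrt (real s) * cos (w t))
        (sqrt (real s) * (sin (w t) * cos (\<phi> t))) (sqrt (real s) * (sin (w t) * sin (\<phi> t))) 0"
    and "\<And>t. t \<in> I \<Longrightarrow> lam t * sqrt (real s) * cos (w t) = \<kappa> 1 t * ((\<kappa> 1 t)\<^sup>2 + (\<kappa> 2 t)\<^sup>2)"
    and "\<And>t. t \<in> I \<Longrightarrow> lam t * sqrt (real s) * (sin (w t) * cos (\<phi> t)) = - (\<kappa> 1 t * deriv (\<kappa> 2) t)"
    and "\<And>t. t \<in> I \<Longrightarrow> lam t * sqrt (real s) * (sin (w t) * sin (\<phi> t)) = - (\<kappa> 1 t * \<kappa> 2 t * \<kappa> 3 t)"
proof -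
  define P Q R where "P t = \<kappa> 1 t * (\<kappa> 1 t * \<kappa> 1 t + \<kappa> 2 t * \<kappa> 2 t)"
    and "Q t = - (\<kappa> 1 t * deriv (\<kappa> 2) t)" and "R t = - (\<kappa> 1 t * \<kappa> 2 t * \<kappa> 3 t)" for t
  note sm = curvature_smooth
  have smPQR: "smooth_on I P" "smooth_on I Q" "smooth_on I R"
    unfolding P_def Q_def R_def
    by (intro smooth_on_uminus smooth_on_mult smooth_on_add smooth_on_deriv sm open_I)+
  have s: "sqrt (real s) > 0" using framed(2) by simp
  have lam: "lam t \<noteq> 0" if "t \<in> I" for t using C that unfolding C_proper_tangent_def by simp
  have eq: "lam t *\<^sub>R Xi t = comb t 0 (P t) (Q t) (R t) 0" if t: "t \<in> I" for t
  proof -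
    have "laplacian_along D (mean_curvature A \<gamma> D) t = lam t *\<^sub>R Xi t"
      by (rule C[unfolded C_proper_tangent_def, THEN conjunct2, THEN conjunct2, rule_format, OF t])
    moreover have "laplacian_along D (mean_curvature A \<gamma> D) t = comb t 0 (P t) (Q t) (R t) 0"
      unfolding P_def Q_def R_def power2_eq_square[symmetric]
      by (rule laplacian_constant_curvature[OF _ t]) (rule const)
    ultimately show ?thesis by (simp only:)
  qed
  define L where "L t = lam t * sqrt (real s)" for t
  have R_neg: "R t < 0" if t: "t \<in> I" for t using curvature_pos[OF t] by (simp add: R_def)
  have L2: "(L t)\<^sup>2 = P t * P t + Q t * Q t + R t * R t" if t: "t \<in> I" for t
  \<comment> \<open>The squared length of \<lambda> \<open>Xi\<close> is evaluated twice: from the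
    length of \<open>Xi\<close> and from the components in the orthonormal frame.\<close>
  proof -
    let ?u = "lam t *\<^sub>R Xi t"
    have T: "?u \<in> tangent_space A (\<gamma> t)" by (rule tangent_space_scaleR[OF Xi_tangent])
    have "g (\<gamma> t) ?u (Xi t) = lam t * real s"
      using riemannian_metric_commute[OF metric T Xi_tangent] metric_Xi_Xi
        linear_at_scaleR[OF metric_linear[OF Xi_tangent] Xi_tangent, of t "lam t"] by simp
    then have "g (\<gamma> t) ?u ?u = lam t * (lam t * real s)"
      using linear_at_scaleR[OF metric_linear[OF T] Xi_tangent, of "lam t"] by simp
    moreover have "g (\<gamma> t) ?u ?u = P t * P t + Q t * Q t + R t * R t"
    proof -
      have "g (\<gamma> t) ?u (E 2 t) = P t" "g (\<gamma> t) ?u (E 3 t) = Q t" "g (\<gamma> t) ?u (E 4 t) = R t"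
        using riemannian_metric_commute[OF metric comb_tangent[OF t] E_tangent[OF _ t]] metric_E_comb[OF t]
        unfolding eq[OF t] by simp_all
      then have "g (\<gamma> t) ?u (comb t 0 (P t) (Q t) (R t) 0) = P t * P t + Q t * Q t + R t * R t"
        by (simp only: metric_comb[OF t T] mult_zero_left add_0_left add_0_right)
      then show ?thesis unfolding eq[OF t] .
    qed
    moreover have "(L t)\<^sup>2 = lam t * (lam t * real s)"
      unfolding L_def power_mult_distrib by (simp add: power2_eq_square[of "lam t"])
    ultimately show ?thesis by (simp only:)
  qed
  obtain \<epsilon> :: real where \<epsilon>: "\<epsilon> = 1 \<or> \<epsilon> = -1" "\<And>t. t \<in> I \<Longrightarrow> \<epsilon> * lam t > 0"
    using continuous_nonzero_constant_sign[OF interval_I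
        differentiable_imp_continuous_on[OF C[unfolded C_proper_tangent_def, THEN conjunct1]] lam] by blast
  have L_pos: "\<epsilon> * L t > 0" if "t \<in> I" for t
    using mult_pos_pos[OF \<epsilon>(2)[OF that] s] by (simp add: L_def mult.assoc)
  have L0: "L t \<noteq> 0" if "t \<in> I" for t using L_pos[OF that] by auto
  have pos: "P t * P t + Q t * Q t + R t * R t > 0" if "t \<in> I" for t
    using L0[OF that] unfolding L2[OF that, symmetric] by simp
  have L_eq: "\<epsilon> * sqrt (P t * P t + Q t * Q t + R t * R t) = L t" if t: "t \<in> I" for t
  proof -
    have "sqrt (P t * P t + Q t * Q t + R t * R t) = \<bar>L t\<bar>" unfolding L2[OF t, symmetric] by simp
    then show ?thesis using L_pos[OF t] \<epsilon>(1) by auto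
  qed
  \<comment> \<open>By definition \<lambda> is only differentiable. Its continuity fixes the sign
    \<epsilon>, and smoothness of L is then read off from the smooth positive radicand.\<close>
  have "smooth_on I (\<lambda>t. \<epsilon> * sqrt (P t * P t + Q t * Q t + R t * R t))"
    using pos by (intro smooth_on_mult smooth_on_const smooth_on_sqrt smooth_on_add smPQR open_I)
  then have smL: "smooth_on I L" using L_eq by (rule smooth_on_cong[OF open_I])
  have smPQ: "smooth_on I (\<lambda>t. P t / L t)" "smooth_on I (\<lambda>t. Q t / L t)"
    by (intro smooth_on_divide smPQR smL open_I L0; assumption)+
  have unit: "(P t / L t)\<^sup>2 + (Q t / L t)\<^sup>2 + (R t / L t)\<^sup>2 = 1" if "t \<in> I" for t
    unfolding power_divide using L2[OF that] pos[OF that]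
    by (simp add: add_divide_distrib[symmetric] power2_eq_square)
  \<comment> \<open>R is negative because the three curvatures are positive, so the E_4-component R
    / L has the constant sign opposite to that of \<lambda>.\<close>
  have c: "- \<epsilon> * (R t / L t) > 0" if "t \<in> I" for t
  proof -
    have "R t / (\<epsilon> * L t) < 0" using R_neg[OF that] L_pos[OF that] by (rule divide_neg_pos)
    then show ?thesis using \<epsilon>(1) by auto
  qed
  obtain w \<phi> where w: "smooth_on I w" "smooth_on I \<phi>"
    and ang: "\<And>t. t \<in> I \<Longrightarrow> cos (w t) = P t / L t \<and> sin (w t) * cos (\<phi> t) = Q t / L t
      \<and> sin (w t) * sin (\<phi> t) = R t / L t"
    using smooth_spherical_coordinates[OF open_I smPQ unit _ c] \<epsilon>(1) by auto
  show thesis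
  proof (rule that[OF w])
    fix t assume t: "t \<in> I"
    have a: "cos (w t) = P t / L t" "sin (w t) * cos (\<phi> t) = Q t / L t" "sin (w t) * sin (\<phi> t) = R t / L t"
      using ang[OF t] by simp_all
    have div: "sqrt (real s) * (x / L t) = inverse (lam t) * x" for x
      using s by (simp add: L_def divide_inverse)
    have "Xi t = inverse (lam t) *\<^sub>R lam t *\<^sub>R Xi t" using lam[OF t] by simp
    also have "\<dots> = comb t 0 (sqrt (real s) * cos (w t))
        (sqrt (real s) * (sin (w t) * cos (\<phi> t))) (sqrt (real s) * (sin (w t) * sin (\<phi> t))) 0"
      unfolding eq[OF t] a div comb_def by (simp add: scaleR_add_right)
    finally show "Xi t = comb t 0 (sqrt (real s) * cos (w t))
        (sqrt (real s) * (sin (w t) * cos (\<phi> t))) (sqrt (real s) * (sin (w t) * sin (\<phi> t))) 0" .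
    show "lam t * sqrt (real s) * cos (w t) = \<kappa> 1 t * ((\<kappa> 1 t)\<^sup>2 + (\<kappa> 2 t)\<^sup>2)"
      "lam t * sqrt (real s) * (sin (w t) * cos (\<phi> t)) = - (\<kappa> 1 t * deriv (\<kappa> 2) t)"
      "lam t * sqrt (real s) * (sin (w t) * sin (\<phi> t)) = - (\<kappa> 1 t * \<kappa> 2 t * \<kappa> 3 t)"
      unfolding a L_def[symmetric] using L0[OF t] by (simp_all add: P_def Q_def R_def power2_eq_square)
  qed
qed

text \<open>The three equations say that \<lambda> \<open>Xi\<close> and the Laplacian have the same
  frame components. The right side of the first is positive, so neither \<lambda> nor cos w
  vanishes, and solving it for \<lambda> exhibits \<lambda> as a quotient of smooth functions, hence
  differentiable.\<close>

lemma spherical_imp_C_proper: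
  assumes w: "smooth_on I w" and const: "\<And>t. t \<in> I \<Longrightarrow> \<kappa> 1 t = k"
    and Xi: "\<And>t. t \<in> I \<Longrightarrow> Xi t = comb t 0 (sqrt (real s) * cos (w t))
        (sqrt (real s) * (sin (w t) * cos (\<phi> t))) (sqrt (real s) * (sin (w t) * sin (\<phi> t))) 0"
    and eq: "\<And>t. t \<in> I \<Longrightarrow> lam t * sqrt (real s) * cos (w t) = \<kappa> 1 t * ((\<kappa> 1 t)\<^sup>2 + (\<kappa> 2 t)\<^sup>2)"
      "\<And>t. t \<in> I \<Longrightarrow> lam t * sqrt (real s) * sin (w t) * cos (\<phi> t) = - (\<kappa> 1 t * deriv (\<kappa> 2) t)"
      "\<And>t. t \<in> I \<Longrightarrow> lam t * sqrt (real s) * sin (w t) * sin (\<phi> t) = - (\<kappa> 1 t * \<kappa> 2 t * \<kappa> 3 t)"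
  shows "C_proper_tangent A s \<xi> I \<gamma> D lam"
proof -
  have ne: "lam t \<noteq> 0" "sqrt (real s) * cos (w t) \<noteq> 0" if t: "t \<in> I" for t
  proof -
    have "\<kappa> 1 t * ((\<kappa> 1 t)\<^sup>2 + (\<kappa> 2 t)\<^sup>2) > 0"
      using curvature_pos[OF t] by (intro mult_pos_pos add_pos_pos) auto
    then show "lam t \<noteq> 0" "sqrt (real s) * cos (w t) \<noteq> 0" using eq(1)[OF t] framed(2) by auto
  qed
  have "smooth_on I (\<lambda>t. \<kappa> 1 t * (\<kappa> 1 t * \<kappa> 1 t + \<kappa> 2 t * \<kappa> 2 t) / (sqrt (real s) * cos (w t)))"
    by (intro smooth_on_divide smooth_on_mult smooth_on_add smooth_on_const smooth_on_cos w curvature_smooth open_I ne)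
  moreover have "\<kappa> 1 t * (\<kappa> 1 t * \<kappa> 1 t + \<kappa> 2 t * \<kappa> 2 t) / (sqrt (real s) * cos (w t)) = lam t" if t: "t \<in> I" for t
    using eq(1)[OF t] ne(2)[OF t] by (simp add: power2_eq_square nonzero_divide_eq_eq mult.assoc)
  ultimately have "smooth_on I lam" by (rule smooth_on_cong[OF open_I])
  moreover have "laplacian_along D (mean_curvature A \<gamma> D) t = lam t *\<^sub>R Xi t" if t: "t \<in> I" for t
  proof -
    have "laplacian_along D (mean_curvature A \<gamma> D) t = comb t 0 (\<kappa> 1 t * ((\<kappa> 1 t)\<^sup>2 + (\<kappa> 2 t)\<^sup>2))
        (- (\<kappa> 1 t * deriv (\<kappa> 2) t)) (- (\<kappa> 1 t * \<kappa> 2 t * \<kappa> 3 t)) 0"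
      by (rule laplacian_constant_curvature[OF _ t]) (rule const)
    also have "\<dots> = lam t *\<^sub>R Xi t"
      unfolding eq(1-3)[OF t, symmetric] Xi[OF t] comb_def by (simp add: scaleR_add_right mult.assoc)
    finally show ?thesis .
  qed
  ultimately show ?thesis
    unfolding C_proper_tangent_def using ne(1) smooth_on_imp_differentiable_on by simp
qed

end

theorem theorem7:
  fixes A :: "('m::{t2_space, second_countable_topology}, 'e::euclidean_space) chart set"
    and n s r :: nat
    and f :: "'m \<Rightarrow> 'm tvec \<Rightarrow> 'm tvec"
    and \<xi> :: "nat \<Rightarrow> 'm vfield"
    and \<eta> :: "nat \<Rightarrow> 'm \<Rightarrow> 'm tvec \<Rightarrow> real"
    and g :: "'m \<Rightarrow> 'm tvec \<Rightarrow> 'm tvec \<Rightarrow> real"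
    and nabla :: "'m vfield \<Rightarrow> 'm vfield \<Rightarrow> 'm vfield"
    and \<alpha> \<beta> :: "nat \<Rightarrow> 'm \<Rightarrow> real"
    and I :: "real set"
    and \<gamma> :: "real \<Rightarrow> 'm"
    and D :: "(real \<Rightarrow> 'm tvec) \<Rightarrow> real \<Rightarrow> 'm tvec"
    and E :: "nat \<Rightarrow> real \<Rightarrow> 'm tvec"
    and \<kappa> :: "nat \<Rightarrow> real \<Rightarrow> real"
    and lam :: "real \<Rightarrow> real"
  assumes "trans_S_manifold A n s f \<xi> \<eta> g nabla \<alpha> \<beta>"
    and "open I" and "is_interval I" and "I \<noteq> {}"
    and "cov_deriv_along A nabla I \<gamma> D"
    and "frenet_curve A g I \<gamma> D r E \<kappa>" and "4 \<le> r"
    and "legendre_curve A s \<eta> I \<gamma>"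
    and "r = 4 \<Longrightarrow> \<forall>t\<in>I. \<kappa> 4 t = 0 \<and> E 5 t = 0"
  shows "C_proper_tangent A s \<xi> I \<gamma> D lam \<longleftrightarrow>
    (\<exists>w \<phi> :: real \<Rightarrow> real. smooth_on I w \<and> smooth_on I \<phi> \<and>
      (\<forall>t\<in>I. (\<Sum>i=1..s. \<xi> i (\<gamma> t)) =
         sqrt (real s) *\<^sub>R (cos (w t) *\<^sub>R E 2 t + (sin (w t) * cos (\<phi> t)) *\<^sub>R E 3 t
                         + (sin (w t) * sin (\<phi> t)) *\<^sub>R E 4 t)) \<and>
      (\<exists>c. \<forall>t\<in>I. \<kappa> 1 t = c) \<and>
      (\<forall>t\<in>I. (\<Sum>i=1..s. \<beta> i (\<gamma> t)) = - (sqrt (real s) * \<kappa> 1 t * cos (w t))) \<and>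
      (\<forall>t\<in>I. lam t * sqrt (real s) * cos (w t) = \<kappa> 1 t * ((\<kappa> 1 t)\<^sup>2 + (\<kappa> 2 t)\<^sup>2)) \<and>
      (\<forall>t\<in>I. lam t * sqrt (real s) * sin (w t) * cos (\<phi> t) = - (\<kappa> 1 t * deriv (\<kappa> 2) t)) \<and>
      (\<forall>t\<in>I. lam t * sqrt (real s) * sin (w t) * sin (\<phi> t) = - (\<kappa> 1 t * \<kappa> 2 t * \<kappa> 3 t)) \<and>
      (\<forall>t\<in>I. \<kappa> 4 t =
         - ((\<Sum>i=1..s. \<alpha> i (\<gamma> t)) * g (\<gamma> t) (f (\<gamma> t) (velocity A \<gamma> t)) (E 5 t))
         / (sqrt (real s) * sin (w t) * sin (\<phi> t))))"
proof -
  interpret legendre_frenet_curve A n s r f \<xi> \<eta> g nabla \<alpha> \<beta> I \<gamma> D E \<kappa>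
    using assms by unfold_locales
  show ?thesis
  proof (rule iffI, goal_cases)
    case C: 1
    from C obtain k where const: "\<And>t. t \<in> I \<Longrightarrow> \<kappa> 1 t = k" using C_proper_imp_constant_curvature[OF C] by blast
    from C_proper_imp_spherical[OF C const] obtain w \<phi> where w: "smooth_on I w" "smooth_on I \<phi>"
      and Xi: "\<And>t. t \<in> I \<Longrightarrow> Xi t = comb t 0 (sqrt (real s) * cos (w t))
          (sqrt (real s) * (sin (w t) * cos (\<phi> t))) (sqrt (real s) * (sin (w t) * sin (\<phi> t))) 0"
      and eq: "\<And>t. t \<in> I \<Longrightarrow> lam t * sqrt (real s) * cos (w t) = \<kappa> 1 t * ((\<kappa> 1 t)\<^sup>2 + (\<kappa> 2 t)\<^sup>2)"
        "\<And>t. t \<in> I \<Longrightarrow> lam t * sqrt (real s) * (sin (w t) * cos (\<phi> t)) = - (\<kappa> 1 t * deriv (\<kappa> 2) t)"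
        "\<And>t. t \<in> I \<Longrightarrow> lam t * sqrt (real s) * (sin (w t) * sin (\<phi> t)) = - (\<kappa> 1 t * \<kappa> 2 t * \<kappa> 3 t)"
      by metis
    have sm: "smooth_on I (\<lambda>t. sqrt (real s) * cos (w t))"
      "smooth_on I (\<lambda>t. sqrt (real s) * (sin (w t) * cos (\<phi> t)))"
      "smooth_on I (\<lambda>t. sqrt (real s) * (sin (w t) * sin (\<phi> t)))"
      by (intro smooth_on_mult smooth_on_const smooth_on_cos smooth_on_sin w open_I)+
    have k4: "\<kappa> 4 t = - ((\<Sum>i=1..s. \<alpha> i (\<gamma> t)) * g (\<gamma> t) (f (\<gamma> t) (velocity A \<gamma> t)) (E 5 t))
        / (sqrt (real s) * sin (w t) * sin (\<phi> t))" if t: "t \<in> I" for t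
    proof -
      \<comment> \<open>The equation for the E_4-component has a nonzero right side, so the
        denominator in the formula for \<kappa>_4 is nonzero and the quotient is equivalent to the
        product identity of \<open>structure_functions_along\<close>.\<close>
      have "\<kappa> 1 t * \<kappa> 2 t * \<kappa> 3 t > 0" using curvature_pos[OF t] by simp
      then have "sqrt (real s) * sin (w t) * sin (\<phi> t) \<noteq> 0" using eq(3)[OF t] framed(2) by auto
      then show ?thesis
        using structure_functions_along(2)[OF sm Xi t]
        unfolding E_velocity[OF t] by (simp only: nonzero_eq_divide_eq mult.assoc simp_thms)
    qed
    have b: "(\<Sum>i=1..s. \<beta> i (\<gamma> t)) = - (sqrt (real s) * \<kappa> 1 t * cos (w t))" if t: "t \<in> I" for t
      using structure_functions_along(1)[OF sm Xi t] mult.left_commute[of "\<kappa> 1 t" "sqrt (real s)" "cos (w t)"]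
      by (simp only: mult.assoc)
    show ?case
      unfolding E_combination
      by (intro exI[of _ w] exI[of _ \<phi>] conjI ballI exI[of _ k] w Xi const b k4 eq(1) eq(2,3)[unfolded mult.assoc[symmetric]])
  next
    case 2
    then obtain w \<phi> k where w: "smooth_on I w"
      and Xi: "\<forall>t\<in>I. Xi t = comb t 0 (sqrt (real s) * cos (w t))
          (sqrt (real s) * (sin (w t) * cos (\<phi> t))) (sqrt (real s) * (sin (w t) * sin (\<phi> t))) 0"
      and const: "\<forall>t\<in>I. \<kappa> 1 t = k"
      and eq: "\<forall>t\<in>I. lam t * sqrt (real s) * cos (w t) = \<kappa> 1 t * ((\<kappa> 1 t)\<^sup>2 + (\<kappa> 2 t)\<^sup>2)"
        "\<forall>t\<in>I. lam t * sqrt (real s) * sin (w t) * cos (\<phi> t) = - (\<kappa> 1 t * deriv (\<kappa> 2) t)"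
        "\<forall>t\<in>I. lam t * sqrt (real s) * sin (w t) * sin (\<phi> t) = - (\<kappa> 1 t * \<kappa> 2 t * \<kappa> 3 t)"
      unfolding E_combination by (elim exE conjE) (rule that)
    show ?case
      by (rule spherical_imp_C_proper[OF w const[rule_format] Xi[rule_format] eq(1)[rule_format]
          eq(2)[rule_format] eq(3)[rule_format]])
  qed
qed

end
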